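(* Let $A$ be an Artin-Schelter regular algebra of global dimension $5$ over a field $k$, generated by two elements of degree one, and let the minimal graded free resolution of the residue field $k$ be $$A \leftarrow A(-1)^2 \leftarrow \bigoplus_{i=1}^n A(-a_i) \leftarrow \bigoplus_{i=1}^n A(a_i-l) \leftarrow A(-l+1)^2 \leftarrow A(-l)$$ with $a_1\le a_2\le\cdots\le a_n$. If $A$ is an integral domain and the Gelfand-Kirillov dimension of $A$ is at least $4$, then one of the following holds: 1. $n=3$ and $(a_1,a_2,a_3)$ is $(3,5,5)$, $(4,4,4)$ or $(3,4,7)$; 2. $n=4$ and $(a_1,a_2,a_3,a_4)$ is $(4,4,4,5)$; 3. $n=5$ and $(a_1,a_2,a_3,a_4,a_5)$ is $(4,4,4,5,5)$.
   Context: A graded algebra $A=k\oplus A_1\oplus A_2\oplus\cdots$ is called Artin-Schelter regular of dimension $d$ if: (i) $A$ has finite global dimension $d$; (ii) $A$ has finite Gelfand-Kirillov dimension (so the Hilbert function $i\mapsto\dim_k A_i$ is bounded by a polynomial); (iii) $A$ is Gorenstein: $\operatorname{Ext}^i_A(k,A)=0$ for $i\ne d$ and $\operatorname{Ext}^d_A(k,A)\cong k(l)$ for some integer $l$, where $k(l)$ is the module $k$ placed in degree $-l$. $A(-j)$ denotes the free module of rank one with generator in degree $j$. For a regular algebra of global dimension $5$ minimally generated by two elements of degree one, the minimal graded free resolution of $k$ necessarily has the displayed form. "Integral domain" means a (not necessarily commutative) ring without zero divisors. *)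

theory Defs
  imports
    Complex_Main
    "HOL-Library.Extended_Nat"
    "HOL-Library.Extended_Real"
    "HOL-Algebra.AbelCoset"
    "HOL-Algebra.Module"
    "HOL-Algebra.Generated_Groups"
begin

text \<open>
  The algebra is the whole type \<open>'a :: ring_1\<close>; modules over it are records of HOL-Algebra, with
  carrier, addition, zero and scalar action (the ring multiplication and unit in these records
  are irrelevant and never inspected). All modules are left modules, except that \<open>Hom(P, A)\<close> and
  \<open>Ext\<close> below carry the right action induced from the right multiplication on \<open>A\<close>; there
  \<open>a \<odot> x\<close> stands for \<open>x a\<close>.
\<close>

section \<open>Connected graded algebras\<close>

locale connected_graded_algebra = vector_space scale
  for scale :: "'k::field \<Rightarrow> 'a::ring_1 \<Rightarrow> 'a" +
  fixes gr :: "nat \<Rightarrow> 'a set"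
  assumes scale_mult_left: "scale c x * y = scale c (x * y)"
    and scale_mult_right: "x * scale c y = scale c (x * y)"
    and gr_subspace: "subspace (gr n)"
    and gr_direct_sum:
      "\<exists>!f. (\<forall>n. f n \<in> gr n) \<and> finite {n. f n \<noteq> 0} \<and> x = (\<Sum>n | f n \<noteq> 0. f n)"
    and gr_mult: "x \<in> gr i \<Longrightarrow> y \<in> gr j \<Longrightarrow> x * y \<in> gr (i + j)"
    and gr_connected: "gr 0 = range (\<lambda>c. scale c 1)"

definition homog_part :: "(nat \<Rightarrow> 'a::ring_1 set) \<Rightarrow> 'a \<Rightarrow> nat \<Rightarrow> 'a" where
  "homog_part gr x =
     (THE f. (\<forall>n. f n \<in> gr n) \<and> finite {n. f n \<noteq> 0} \<and> x = (\<Sum>n | f n \<noteq> 0. f n))"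

definition augmentation :: "('k::field \<Rightarrow> 'a::ring_1 \<Rightarrow> 'a) \<Rightarrow> (nat \<Rightarrow> 'a set) \<Rightarrow> 'a \<Rightarrow> 'k" where
  "augmentation scale gr x = (THE c. scale c 1 = homog_part gr x 0)"

definition augmentation_ideal :: "(nat \<Rightarrow> 'a::ring_1 set) \<Rightarrow> 'a set" where
  "augmentation_ideal gr = {x. homog_part gr x 0 = 0}"

definition gr_int :: "(nat \<Rightarrow> 'a::ring_1 set) \<Rightarrow> int \<Rightarrow> 'a set" where
  "gr_int gr n = (if n < 0 then {0} else gr (nat n))"

definition generated_by :: "('k::field \<Rightarrow> 'a::ring_1 \<Rightarrow> 'a) \<Rightarrow> 'a set \<Rightarrow> bool" where
  "generated_by scale S \<longleftrightarrow>
     Modules.module.span scale {prod_list xs | xs. set xs \<subseteq> S} = UNIV"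

text \<open>
  The Gelfand-Kirillov dimension: the supremum, over the finite-dimensional subspaces \<open>V\<close>, of
  \<open>limsup log\<^sub>n (dim (k + V + V\<^sup>2 + \<dots> + V\<^sup>n))\<close>.
\<close>

definition GKdim :: "('k::field \<Rightarrow> 'a::ring_1 \<Rightarrow> 'a) \<Rightarrow> ereal" where
  "GKdim scale =
     (SUP V \<in> {Modules.module.span scale S | S. finite S}.
        limsup (\<lambda>n. ereal (log (real n) (real (vector_space.dim scale
          (Modules.module.span scale {prod_list xs | xs. set xs \<subseteq> V \<and> length xs \<le> n}))))))"


section \<open>Modules and global dimension\<close>

locale left_module = abelian_group M
  for M :: "('a::ring_1, 'm, 'z) module_scheme" (structure) +
  assumes smult_closed: "x \<in> carrier M \<Longrightarrow> a \<odot> x \<in> carrier M"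
    and smult_add_left: "x \<in> carrier M \<Longrightarrow> (a + b) \<odot> x = a \<odot> x \<oplus> b \<odot> x"
    and smult_add_right:
      "x \<in> carrier M \<Longrightarrow> y \<in> carrier M \<Longrightarrow> a \<odot> (x \<oplus> y) = a \<odot> x \<oplus> a \<odot> y"
    and smult_assoc: "x \<in> carrier M \<Longrightarrow> (a * b) \<odot> x = a \<odot> (b \<odot> x)"
    and smult_one: "x \<in> carrier M \<Longrightarrow> 1 \<odot> x = x"

definition lmod_hom ::
  "('a::ring_1, 'm, 'y) module_scheme \<Rightarrow> ('a, 'n, 'z) module_scheme \<Rightarrow> ('m \<Rightarrow> 'n) set" where
  "lmod_hom M N = {f \<in> hom (add_monoid M) (add_monoid N).
     \<forall>a. \<forall>x \<in> carrier M. f (a \<odot>\<^bsub>M\<^esub> x) = a \<odot>\<^bsub>N\<^esub> f x}"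

text \<open>
  HOL cannot quantify over all modules on all types, so the notions below quantify over the modules
  carried by subsets of \<open>nat \<Rightarrow> 'a\<close>. This is no restriction: this universe contains (copies of) all
  countably generated modules, in particular all cyclic ones, which determine the
  global dimension; and as \<open>nat \<Rightarrow> 'a\<close> is infinite and at least as large as \<open>'a\<close>, every module in
  it is a quotient of a free module in it, so that projectivity and projective dimension of
  its members do not depend on it either. It also contains the free modules \<open>A\<^sup>r\<close> used below.
\<close>

definition projective :: "('a::ring_1, nat \<Rightarrow> 'a, 'z) module_scheme \<Rightarrow> bool" where
  "projective P \<longleftrightarrow> left_module P \<and>
     (\<forall>(M :: ('a, nat \<Rightarrow> 'a) module) (N :: ('a, nat \<Rightarrow> 'a) module) g f.
        left_module M \<longrightarrow> left_module N \<longrightarrow>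
        g \<in> lmod_hom M N \<longrightarrow> g ` carrier M = carrier N \<longrightarrow> f \<in> lmod_hom P N \<longrightarrow>
        (\<exists>h \<in> lmod_hom P M. \<forall>x \<in> carrier P. g (h x) = f x))"

text \<open>Exactness of \<open>\<dots> \<rightarrow> P 2 \<rightarrow> P 1 \<rightarrow> P 0 \<rightarrow> M \<rightarrow> 0\<close>, with \<open>d i : P (i + 1) \<rightarrow> P i\<close>.\<close>

definition resolution ::
  "('a::ring_1, 'n, 'y) module_scheme \<Rightarrow> (nat \<Rightarrow> ('a, 'm, 'z) module_scheme) \<Rightarrow>
   (nat \<Rightarrow> 'm \<Rightarrow> 'm) \<Rightarrow> ('m \<Rightarrow> 'n) \<Rightarrow> bool" where
  "resolution M P d \<epsilon> \<longleftrightarrow>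
     (\<forall>i. left_module (P i)) \<and>
     \<epsilon> \<in> lmod_hom (P 0) M \<and> (\<forall>i. d i \<in> lmod_hom (P (Suc i)) (P i)) \<and>
     \<epsilon> ` carrier (P 0) = carrier M \<and>
     d 0 ` carrier (P 1) = {x \<in> carrier (P 0). \<epsilon> x = \<zero>\<^bsub>M\<^esub>} \<and>
     (\<forall>i. d (Suc i) ` carrier (P (Suc (Suc i))) =
            {x \<in> carrier (P (Suc i)). d i x = \<zero>\<^bsub>P i\<^esub>})"

definition projdim :: "('a::ring_1, 'n, 'y) module_scheme \<Rightarrow> enat" where
  "projdim M = Inf {enat n | n.
     \<exists>(P :: nat \<Rightarrow> ('a, nat \<Rightarrow> 'a) module) d \<epsilon>. resolution M P d \<epsilon> \<and>
       (\<forall>i. projective (P i)) \<and> (\<forall>i>n. carrier (P i) = {\<zero>\<^bsub>P i\<^esub>})}"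

definition gldim :: "'a::ring_1 itself \<Rightarrow> enat" where
  "gldim _ = (SUP M \<in> {M :: ('a, nat \<Rightarrow> 'a) module. left_module M}. projdim M)"


section \<open>Graded modules\<close>

record ('a, 'm) gmodule = "('a, 'm) module" +
  gcomp :: "int \<Rightarrow> 'm set"

locale graded_left_module = left_module M
  for gr :: "nat \<Rightarrow> 'a::ring_1 set" and M :: "('a, 'm, 'z) gmodule_scheme" (structure) +
  assumes gcomp_subgroup: "subgroup (gcomp M n) (add_monoid M)"
    and gcomp_direct_sum:
      "x \<in> carrier M \<Longrightarrow> \<exists>!f. (\<forall>n. f n \<in> gcomp M n) \<and> finite {n. f n \<noteq> \<zero>} \<and>
         x = (\<Oplus>n \<in> {n. f n \<noteq> \<zero>}. f n)"
    and gcomp_smult: "a \<in> gr i \<Longrightarrow> x \<in> gcomp M n \<Longrightarrow> a \<odot> x \<in> gcomp M (int i + n)"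

text \<open>
  The free module with generators in the degrees \<open>ds\<close>, i.e.\ the direct sum of the \<open>A(-j)\<close> for
  \<open>j\<close> in the list \<open>ds\<close>, as the \<open>A\<close>-valued sequences vanishing from index \<open>length ds\<close> on.
\<close>

definition gfree :: "(nat \<Rightarrow> 'a::ring_1 set) \<Rightarrow> int list \<Rightarrow> ('a, nat \<Rightarrow> 'a) gmodule" where
  "gfree gr ds =
     \<lparr>carrier = {v. \<forall>i \<ge> length ds. v i = 0},
      monoid.mult = undefined, one = undefined,
      zero = (\<lambda>_. 0), add = (\<lambda>v w i. v i + w i),
      smult = (\<lambda>a v i. a * v i),
      gcomp = (\<lambda>n. {v. (\<forall>i < length ds. v i \<in> gr_int gr (n - ds ! i)) \<and>
                       (\<forall>i \<ge> length ds. v i = 0)})\<rparr>"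

text \<open>
  The module \<open>k(s)\<close>: the field \<open>k\<close> placed in degree \<open>-s\<close>, with \<open>A\<close> acting through the
  augmentation. As \<open>k\<close> is commutative, it serves both as a left and as a right module.
\<close>

definition k_module ::
  "('k::field \<Rightarrow> 'a::ring_1 \<Rightarrow> 'a) \<Rightarrow> (nat \<Rightarrow> 'a set) \<Rightarrow> int \<Rightarrow> ('a, 'k) gmodule" where
  "k_module scale gr s =
     \<lparr>carrier = UNIV, monoid.mult = undefined, one = undefined,
      zero = 0, add = (+), smult = (\<lambda>a c. augmentation scale gr a * c),
      gcomp = (\<lambda>n. if n = - s then UNIV else {0})\<rparr>"

definition gmod_iso ::
  "('a::ring_1, 'm, 'y) gmodule_scheme \<Rightarrow> ('a, 'n, 'z) gmodule_scheme \<Rightarrow> bool" where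
  "gmod_iso M N \<longleftrightarrow>
     (\<exists>\<phi> \<in> lmod_hom M N. bij_betw \<phi> (carrier M) (carrier N) \<and>
        (\<forall>n. \<phi> ` gcomp M n = gcomp N n))"

definition graded_resolution ::
  "(nat \<Rightarrow> 'a::ring_1 set) \<Rightarrow> ('a, 'n, 'y) gmodule_scheme \<Rightarrow>
   (nat \<Rightarrow> ('a, 'm, 'z) gmodule_scheme) \<Rightarrow> (nat \<Rightarrow> 'm \<Rightarrow> 'm) \<Rightarrow> ('m \<Rightarrow> 'n) \<Rightarrow> bool" where
  "graded_resolution gr M P d \<epsilon> \<longleftrightarrow>
     resolution M P d \<epsilon> \<and> (\<forall>i. graded_left_module gr (P i)) \<and>
     (\<forall>n. \<epsilon> ` gcomp (P 0) n \<subseteq> gcomp M n) \<and>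
     (\<forall>i n. d i ` gcomp (P (Suc i)) n \<subseteq> gcomp (P i) n)"

text \<open>The submodule \<open>A\<^sub>+ M\<close>, and minimality: the differentials map into \<open>A\<^sub>+ P i\<close>.\<close>

definition aug_submodule ::
  "(nat \<Rightarrow> 'a::ring_1 set) \<Rightarrow> ('a, 'm, 'z) module_scheme \<Rightarrow> 'm set" where
  "aug_submodule gr M = generate (add_monoid M)
     {a \<odot>\<^bsub>M\<^esub> x | a x. a \<in> augmentation_ideal gr \<and> x \<in> carrier M}"

definition minimal_graded_resolution ::
  "(nat \<Rightarrow> 'a::ring_1 set) \<Rightarrow> ('a, 'n, 'y) gmodule_scheme \<Rightarrow>
   (nat \<Rightarrow> ('a, 'm, 'z) gmodule_scheme) \<Rightarrow> (nat \<Rightarrow> 'm \<Rightarrow> 'm) \<Rightarrow> ('m \<Rightarrow> 'n) \<Rightarrow> bool" where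
  "minimal_graded_resolution gr M P d \<epsilon> \<longleftrightarrow>
     graded_resolution gr M P d \<epsilon> \<and>
     (\<forall>i. d i ` carrier (P (Suc i)) \<subseteq> aug_submodule gr (P i))"


section \<open>Ext into the algebra\<close>

text \<open>
  The \<open>A\<close>-linear maps \<open>P \<rightarrow> A\<close> of degree \<open>j\<close>, normalised to be \<open>0\<close> outside the carrier of \<open>P\<close>.
\<close>

definition ghom_deg ::
  "(nat \<Rightarrow> 'a::ring_1 set) \<Rightarrow> ('a, 'm, 'z) gmodule_scheme \<Rightarrow> int \<Rightarrow> ('m \<Rightarrow> 'a) set" where
  "ghom_deg gr P j =
     {f. (\<forall>x \<in> carrier P. \<forall>y \<in> carrier P. f (x \<oplus>\<^bsub>P\<^esub> y) = f x + f y) \<and>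
         (\<forall>a. \<forall>x \<in> carrier P. f (a \<odot>\<^bsub>P\<^esub> x) = a * f x) \<and>
         (\<forall>n. f ` gcomp P n \<subseteq> gr_int gr (n + j)) \<and>
         (\<forall>x. x \<notin> carrier P \<longrightarrow> f x = 0)}"

text \<open>The graded right module of homomorphisms \<open>P \<rightarrow> A\<close>: the direct sum over all degrees.\<close>

definition ghom :: "(nat \<Rightarrow> 'a::ring_1 set) \<Rightarrow> ('a, 'm, 'z) gmodule_scheme \<Rightarrow>
    ('a, 'm \<Rightarrow> 'a) gmodule" where
  "ghom gr P =
     \<lparr>carrier = {f. \<exists>J F. finite J \<and> (\<forall>j \<in> J. F j \<in> ghom_deg gr P j) \<and>
                       f = (\<lambda>x. \<Sum>j\<in>J. F j x)},
      monoid.mult = undefined, one = undefined,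
      zero = (\<lambda>_. 0), add = (\<lambda>f g x. f x + g x),
      smult = (\<lambda>a f x. f x * a),
      gcomp = ghom_deg gr P\<rparr>"

definition Ext_cocycles ::
  "(nat \<Rightarrow> 'a::ring_1 set) \<Rightarrow> (nat \<Rightarrow> ('a, 'm) gmodule) \<Rightarrow> (nat \<Rightarrow> 'm \<Rightarrow> 'm) \<Rightarrow>
   nat \<Rightarrow> ('m \<Rightarrow> 'a) set" where
  "Ext_cocycles gr P d i =
     {f \<in> carrier (ghom gr (P i)). \<forall>x \<in> carrier (P (Suc i)). f (d i x) = 0}"

fun Ext_coboundaries ::
  "(nat \<Rightarrow> 'a::ring_1 set) \<Rightarrow> (nat \<Rightarrow> ('a, 'm) gmodule) \<Rightarrow> (nat \<Rightarrow> 'm \<Rightarrow> 'm) \<Rightarrow>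
   nat \<Rightarrow> ('m \<Rightarrow> 'a) set" where
  "Ext_coboundaries gr P d 0 = {\<lambda>_. 0}"
| "Ext_coboundaries gr P d (Suc i) =
     {(\<lambda>x. if x \<in> carrier (P (Suc i)) then g (d i x) else 0) | g. g \<in> carrier (ghom gr (P i))}"

text \<open>
  The graded right module \<open>Ext\<^sup>i(M, A)\<close> computed from the graded projective resolution \<open>(P, d)\<close>
  of \<open>M\<close>; its elements are cosets of the coboundaries.
\<close>

definition Ext_module ::
  "(nat \<Rightarrow> 'a::ring_1 set) \<Rightarrow> (nat \<Rightarrow> ('a, 'm) gmodule) \<Rightarrow> (nat \<Rightarrow> 'm \<Rightarrow> 'm) \<Rightarrow>
   nat \<Rightarrow> ('a, ('m \<Rightarrow> 'a) set) gmodule" where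
  "Ext_module gr P d i =
     (let H = ghom gr (P i); Z = Ext_cocycles gr P d i; B = Ext_coboundaries gr P d i in
      \<lparr>carrier = {B +>\<^bsub>H\<^esub> f | f. f \<in> Z},
       monoid.mult = undefined, one = undefined,
       zero = B, add = (\<lambda>X Y. X <+>\<^bsub>H\<^esub> Y),
       smult = (\<lambda>a X. \<Union>f\<in>X. B +>\<^bsub>H\<^esub> (a \<odot>\<^bsub>H\<^esub> f)),
       gcomp = (\<lambda>n. {B +>\<^bsub>H\<^esub> f | f. f \<in> Z \<and> f \<in> gcomp H n})\<rparr>)"


section \<open>Artin-Schelter regular algebras\<close>

text \<open>
  Since \<open>Ext\<close> does not depend on the resolution, and graded free resolutions of \<open>k\<close> exist within
  \<open>nat \<Rightarrow> 'a\<close>, the Gorenstein condition may be required for every graded projective resolution there.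
\<close>

definition Gorenstein ::
  "('k::field \<Rightarrow> 'a::ring_1 \<Rightarrow> 'a) \<Rightarrow> (nat \<Rightarrow> 'a set) \<Rightarrow> nat \<Rightarrow> bool" where
  "Gorenstein scale gr D \<longleftrightarrow>
     (\<exists>l. \<forall>(P :: nat \<Rightarrow> ('a, nat \<Rightarrow> 'a) gmodule) d \<epsilon>.
        graded_resolution gr (k_module scale gr 0) P d \<epsilon> \<and> (\<forall>i. projective (P i)) \<longrightarrow>
          (\<forall>i. i \<noteq> D \<longrightarrow> carrier (Ext_module gr P d i) = {\<zero>\<^bsub>Ext_module gr P d i\<^esub>}) \<and>
          gmod_iso (Ext_module gr P d D) (k_module scale gr l))"

locale AS_regular_algebra = connected_graded_algebra scale gr
  for scale :: "'k::field \<Rightarrow> 'a::ring_1 \<Rightarrow> 'a" and gr :: "nat \<Rightarrow> 'a set" +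
  fixes D :: nat
  assumes gldim_eq: "gldim TYPE('a) = enat D"
    and GKdim_finite: "GKdim scale < \<infinity>"
    and Gorenstein: "Gorenstein scale gr D"

end

theory Submission
  imports Defs "HOL-Library.Function_Algebras" "HOL-Computational_Algebra.Polynomial"
begin

text \<open>
  In an algebra of finite Gelfand-Kirillov dimension, \<open>A\<close>-linearly independent elements of \<open>A\<^sup>s\<close> are
  at most \<open>s\<close> in number, as more of them would force exponential growth. For a domain, this rank
  bound applied to the resolution gives \<open>a\<^sub>i + a\<^sub>j < l\<close> whenever \<open>i + j = n + 2\<close> and \<open>i, j \<ge> 2\<close>.
  The Hilbert series is \<open>1 / F\<close>, where \<open>F\<close> is the alternating sum of the \<open>t\<^sup>j\<close> over the degrees \<open>j\<close> of
  the generators in the resolution, and the Gelfand-Kirillov dimension is at most the order of the zero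
  of \<open>F\<close> at \<open>1\<close>. So this order is at least \<open>4\<close>, which amounts to a linear and a cubic equation
  for the \<open>a\<^sub>i\<close> and \<open>l\<close>. Together with the inequalities these have only the listed solutions.
\<close>

section \<open>Dimensions of subspaces\<close>

text \<open>The rank bound stands in for linear algebra over a skew field of fractions: there a free
  module of rank s would become an s-dimensional space, here the number of left independent vectors
  is read off from growth. The domain hypothesis lets a nonzero coordinate be cancelled, which is
  what makes the chosen vectors independent. The obstacle in the degree inequality is the
  injectivity of a corner of the middle differential. A kernel vector would lift to
  \<open>P 4\<close>, of rank 2, where the image of the last term and a generator with nonzero first
  coordinate in \<open>P 3\<close> already exhaust the rank. That such a generator exists is where
  the Gorenstein condition enters. The polynomial satisfies F(t) = - t^l F(1/t), so its zero at 1
  has odd order and the conditions of even order follow from the odd ones. In the variables l - 2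
  a_i the surviving conditions are power sums with the values 2 (l - 2)^k - l^k for k = 1 and k = 3,
  contributed by the generators of degrees 0, 1, l - 1 and l.\<close>

context vector_space
begin

lemma finite_independent_in_span:
  assumes "independent C" "C \<subseteq> V" "V \<subseteq> span B" "finite B"
  shows "finite C"
  using assms independent_span_bound[of B C] by auto

text \<open>\<open>dim\<close> is the cardinality of a basis, hence 0 for an infinite-dimensional
  space; monotonicity therefore asks for a finite spanning set of the larger space.\<close>

lemma dim_mono_spanned:
  assumes "U \<subseteq> span V" "V \<subseteq> span B" "finite B"
  shows "dim U \<le> dim V"
proof -
  obtain C where C: "C \<subseteq> V" "independent C" "V \<subseteq> span C" "card C = dim V"
    using basis_exists by blast
  have "finite C" using finite_independent_in_span[OF C(2,1)] assms by auto
  moreover have "U \<subseteq> span C" using assms(1) C(3) span_mono span_span by blast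
  ultimately show ?thesis using dim_le_card[of U C] C(4) by simp
qed

lemma dim_eq_0_spanned:
  assumes "V \<subseteq> {0}" shows "dim V = 0"
proof -
  have "V \<subseteq> span {}" using assms by simp
  from dim_le_card[OF this] show ?thesis by simp
qed

text \<open>The coordinates of \<open>x\<close> with respect to \<open>E\<close> are supported both
  in \<open>C\<close> and outside \<open>C\<close>.\<close>

lemma span_Int_span_independent:
  assumes "independent E" "C \<subseteq> E" "x \<in> span C" "x \<in> span (E - C)"
  shows "x = 0"
proof -
  have "representation E x = representation C x" "representation E x = representation (E - C) x"
    using assms by (auto intro: representation_extend)
  then have "representation E x b = 0" for b
    using representation_ne_zero[of C x b] representation_ne_zero[of "E - C" x b] by auto
  moreover have "x \<in> span E" using assms span_mono by blast
  ultimately show ?thesis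
    using sum_nonzero_representation_eq[OF assms(1), of x] by simp
qed

end

context vector_space_pair
begin

text \<open>The ambient spaces below are infinite-dimensional, so the count is made on a finitely
  spanned subspace \<open>S\<close>. A basis \<open>C\<close> of the kernel extends to a basis
  \<open>E\<close> of \<open>S\<close>, and \<open>f\<close> is injective on the span of
  \<open>E - C\<close>.\<close>

theorem rank_nullity:
  assumes f: "Vector_Spaces.linear s1 s2 f" and S: "vs1.subspace S" "S \<subseteq> vs1.span B" "finite B"
  shows "vs1.dim S = vs2.dim (f ` S) + vs1.dim {x \<in> S. f x = 0}"
proof -
  let ?K = "{x \<in> S. f x = 0}"
  obtain C where C: "C \<subseteq> ?K" "vs1.independent C" "?K \<subseteq> vs1.span C" "card C = vs1.dim ?K"
    using vs1.basis_exists by blast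
  have "C \<subseteq> S" using C by auto
  then obtain E where E: "C \<subseteq> E" "E \<subseteq> S" "vs1.independent E" "S \<subseteq> vs1.span E"
    using vs1.maximal_independent_subset_extend C(2) by metis
  have fE: "finite E" using vs1.finite_independent_in_span[OF E(3,2) S(2,3)] .
  have sE: "vs1.span E \<subseteq> S" using E(2) S(1) vs1.span_minimal by blast
  have K: "vs1.subspace ?K"
    using linear_subspace_kernel[OF f] S(1) vs1.subspace_inter[of S "{x. f x = 0}"]
    by (simp add: Int_def)
  have inj: "inj_on f (vs1.span (E - C))"
  proof (subst linear_inj_on_iff_eq_0[OF f vs1.subspace_span], intro ballI impI)
    fix x assume x: "x \<in> vs1.span (E - C)" "f x = 0"
    then have "x \<in> S" using sE vs1.span_mono[of "E - C" E] by auto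
    then have "x \<in> vs1.span C" using x C(3) by auto
    then show "x = 0" using vs1.span_Int_span_independent[OF E(3,1)] x(1) by blast
  qed
  have ind: "vs2.independent (f ` (E - C))"
    using linear_independent_injective_image[OF f vs1.independent_mono[OF E(3)] inj] by simp
  have "f ` S \<subseteq> vs2.span (f ` (E - C))"
  proof -
    have "f ` S \<subseteq> vs2.span (f ` E)"
      using E(4) linear_span_image[OF f, of E] by auto
    also have "\<dots> \<subseteq> vs2.span (insert 0 (f ` (E - C)))"
      using C(1) by (intro vs2.span_mono) auto
    finally show ?thesis by simp
  qed
  moreover have "f ` (E - C) \<subseteq> f ` S" using E(2) by (intro image_mono) auto
  ultimately have "vs2.dim (f ` S) = card (f ` (E - C))"
    using vs2.basis_card_eq_dim ind by metis
  also have "\<dots> = card (E - C)"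
    using inj_on_subset[OF inj vs1.span_superset] by (rule card_image)
  also have "\<dots> = card E - card C" using fE E(1) by (simp add: card_Diff_subset finite_subset)
  finally have "vs2.dim (f ` S) = card E - card C" .
  moreover have "card E = vs1.dim S" using vs1.basis_card_eq_dim E by blast
  moreover have "card C \<le> card E" using fE E(1) by (rule card_mono)
  ultimately show ?thesis using C(4) by simp
qed

end

section \<open>Finite direct sums inside the space of sequences\<close>

definition seq_scale :: "('k \<Rightarrow> 'a \<Rightarrow> 'a) \<Rightarrow> 'k \<Rightarrow> (nat \<Rightarrow> 'a) \<Rightarrow> nat \<Rightarrow> 'a" where
  "seq_scale s c v = (\<lambda>i. s c (v i))"

text \<open>The direct sum of the \<open>X i\<close> in the encoding of \<open>gfree\<close>. With
  filtration steps as \<open>X i\<close> it serves the growth argument, with shifted homogeneous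
  components it is a graded piece of a free module.\<close>

definition seq_box :: "nat \<Rightarrow> (nat \<Rightarrow> 'a::zero set) \<Rightarrow> (nat \<Rightarrow> 'a) set" where
  "seq_box r X = {v. (\<forall>i<r. v i \<in> X i) \<and> (\<forall>i\<ge>r. v i = 0)}"

context vector_space
begin

lemma vector_space_seq: "vector_space (seq_scale scale)"
  by unfold_locales (auto simp: seq_scale_def algebra_simps)

interpretation seq: vector_space "seq_scale scale"
  by (rule vector_space_seq)

lemma seq_pair: "vector_space_pair (seq_scale scale) scale"
  by unfold_locales

lemma subspace_seq_box:
  "(\<And>i. i < r \<Longrightarrow> subspace (X i)) \<Longrightarrow> seq.subspace (seq_box r X)"
  unfolding seq.subspace_def seq_box_def
  by (auto simp: seq_scale_def subspace_def)

text \<open>The dimension count runs through the projection to the last coordinate.\<close>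

lemma dim_seq_box:
  assumes "\<And>i. i < r \<Longrightarrow> subspace (X i)" "\<And>i. i < r \<Longrightarrow> \<exists>B. finite B \<and> X i \<subseteq> span B"
  shows "(\<exists>B. finite B \<and> seq_box r X \<subseteq> seq.span B) \<and> seq.dim (seq_box r X) = (\<Sum>i<r. dim (X i))"
  using assms
proof (induction r)
  case 0
  have "seq_box 0 X = {0}" by (auto simp: seq_box_def fun_eq_iff)
  then show ?case using seq.dim_eq_0_spanned[of "{0}"] by (auto intro: exI[of _ "{0}"] seq.span_base)
next
  case (Suc r)
  from Suc.IH[OF Suc.prems] obtain B where
    B: "finite B" "seq_box r X \<subseteq> seq.span B" and d: "seq.dim (seq_box r X) = (\<Sum>i<r. dim (X i))"
    by auto
  obtain C where C: "finite C" "X r \<subseteq> span C" using Suc.prems(2)[of r] by auto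
  define u where "u = (\<lambda>c::'b. (\<lambda>i::nat. if i = r then c else 0))"
  have sub: "seq.subspace (seq_box (Suc r) X)" by (rule subspace_seq_box) (rule Suc.prems)
  interpret u: Vector_Spaces.linear scale "seq_scale scale" u
    by unfold_locales (auto simp: u_def seq_scale_def fun_eq_iff)
  have span: "seq_box (Suc r) X \<subseteq> seq.span (B \<union> u ` C)"
  proof
    fix v assume v: "v \<in> seq_box (Suc r) X"
    have "v(r := 0) \<in> seq_box r X" using v by (auto simp: seq_box_def)
    then have 1: "v(r := 0) \<in> seq.span (B \<union> u ` C)" using B(2) seq.span_mono[of B "B \<union> u ` C"] by auto
    have "v r \<in> span C" using v C(2) by (auto simp: seq_box_def)
    then have "u (v r) \<in> seq.span (u ` C)" using u.span_image[of C] by blast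
    then have 2: "u (v r) \<in> seq.span (B \<union> u ` C)" using seq.span_mono[of "u ` C" "B \<union> u ` C"] by auto
    have "v = v(r := 0) + u (v r)" by (auto simp: u_def fun_eq_iff)
    then show "v \<in> seq.span (B \<union> u ` C)" using seq.span_add[OF 1 2] by simp
  qed
  interpret p: vector_space_pair "seq_scale scale" scale by (rule seq_pair)
  have lin: "Vector_Spaces.linear (seq_scale scale) scale (\<lambda>v. v r)"
    by unfold_locales (auto simp: seq_scale_def)
  have ker: "{x \<in> seq_box (Suc r) X. x r = 0} = seq_box r X"
  proof (intro equalityI subsetI)
    fix x assume x: "x \<in> {x \<in> seq_box (Suc r) X. x r = 0}"
    then have "x i = 0" if "i \<ge> r" for i
      using that by (cases "i = r") (auto simp: seq_box_def)
    then show "x \<in> seq_box r X" using x by (simp add: seq_box_def)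
  next
    fix x assume x: "x \<in> seq_box r X"
    then have "x i \<in> X i" if "i < Suc r" for i
      using that subspace_0[OF Suc.prems(1)[of r]] by (cases "i = r") (auto simp: seq_box_def)
    then show "x \<in> {x \<in> seq_box (Suc r) X. x r = 0}" using x by (auto simp: seq_box_def)
  qed
  have "(\<lambda>v. v r) ` seq_box (Suc r) X = X r"
  proof (intro equalityI subsetI)
    fix c assume "c \<in> X r"
    then have "u c \<in> seq_box (Suc r) X"
      using subspace_0[OF Suc.prems(1)] by (simp add: seq_box_def u_def)
    then show "c \<in> (\<lambda>v. v r) ` seq_box (Suc r) X"
      by (intro image_eqI[of _ _ "u c"]) (simp_all add: u_def)
  qed (auto simp: seq_box_def)
  moreover have fin: "finite (B \<union> u ` C)" using B(1) C(1) by simp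
  ultimately have "seq.dim (seq_box (Suc r) X) = (\<Sum>i<Suc r. dim (X i))"
    using p.rank_nullity[OF lin sub span] by (simp only: ker d sum.lessThan_Suc add.commute)
  then show ?case using span fin by (intro conjI exI[of _ "B \<union> u ` C"])
qed

end

section \<open>Growth and rank\<close>

text \<open>The substitution x = n ln c in the limit x^K / e^x -> 0.\<close>

lemma eventually_power_le_exp:
  fixes c :: real
  assumes c: "c > 1"
  shows "eventually (\<lambda>n. real n ^ K \<le> c ^ n) sequentially"
proof -
  have lc: "ln c > 0" using c by simp
  have "filterlim (\<lambda>n::nat. ln c * real n) at_top sequentially"
    by (rule filterlim_tendsto_pos_mult_at_top[OF tendsto_const lc filterlim_real_sequentially])
  then have "(\<lambda>n. (ln c * real n) ^ K / exp (ln c * real n)) \<longlonglongrightarrow> 0"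
    using filterlim_compose[OF tendsto_power_div_exp_0] by blast
  moreover have "ln c ^ K > 0" using lc by simp
  ultimately have "eventually (\<lambda>n. (ln c * real n) ^ K / exp (ln c * real n) < ln c ^ K) sequentially"
    by (rule order_tendstoD(2))
  then show ?thesis
  proof eventually_elim
    case (elim n)
    have e: "exp (ln c * real n) = c ^ n"
      using c by (metis exp_ln exp_of_nat2_mult less_trans zero_less_one)
    have "ln c ^ K * real n ^ K < ln c ^ K * c ^ n"
      using elim c unfolding e power_mult_distrib by (simp add: divide_less_eq)
    then have "real n ^ K < c ^ n" using lc by simp
    then show ?case by simp
  qed
qed

section \<open>Homogeneous components and the augmentation ideal\<close>

context connected_graded_algebra
begin

lemma homog_part_props:
  shows "homog_part gr x n \<in> gr n" "finite {n. homog_part gr x n \<noteq> 0}"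
    "x = (\<Sum>n | homog_part gr x n \<noteq> 0. homog_part gr x n)"
  using theI'[OF gr_direct_sum[of x]] unfolding homog_part_def by blast+

text \<open>\<open>N\<close> may be any finite set containing the support, so that sums and products
  are handled without knowing which components cancel.\<close>

lemma homog_part_eqI:
  assumes "\<And>n. f n \<in> gr n" "finite N" "\<And>n. n \<notin> N \<Longrightarrow> f n = 0" "x = (\<Sum>n\<in>N. f n)"
  shows "homog_part gr x = f"
proof -
  have sub: "{n. f n \<noteq> 0} \<subseteq> N" using assms(3) by blast
  have "(\<Sum>n | f n \<noteq> 0. f n) = (\<Sum>n\<in>N. f n)"
    by (rule sum.mono_neutral_left) (use assms(2) sub in auto)
  then have "(\<forall>n. f n \<in> gr n) \<and> finite {n. f n \<noteq> 0} \<and> x = (\<Sum>n | f n \<noteq> 0. f n)"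
    using assms finite_subset[OF sub] by auto
  then show ?thesis unfolding homog_part_def using gr_direct_sum[of x] by (intro the1_equality)
qed

lemma zero_in_gr: "0 \<in> gr n"
  using gr_subspace subspace_0 by blast

lemma homog_part_homog: "x \<in> gr n \<Longrightarrow> homog_part gr x m = (if m = n then x else 0)"
  using homog_part_eqI[of "\<lambda>m. if m = n then x else 0" "{n}" x] zero_in_gr by auto

lemma homog_part_0: "homog_part gr 0 n = 0"
  using homog_part_homog[OF zero_in_gr, of n] by simp

lemma homog_part_sum_superset:
  "finite N \<Longrightarrow> {n. homog_part gr x n \<noteq> 0} \<subseteq> N \<Longrightarrow> x = (\<Sum>n\<in>N. homog_part gr x n)"
  using homog_part_props(3)[of x] by (subst sum.mono_neutral_right[of N "{n. homog_part gr x n \<noteq> 0}"]) auto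

lemma homog_part_add: "homog_part gr (x + y) n = homog_part gr x n + homog_part gr y n"
proof -
  let ?N = "{n. homog_part gr x n \<noteq> 0} \<union> {n. homog_part gr y n \<noteq> 0}"
  have fin: "finite ?N" using homog_part_props(2) by simp
  have "x + y = (\<Sum>n\<in>?N. homog_part gr x n) + (\<Sum>n\<in>?N. homog_part gr y n)"
    using homog_part_sum_superset[OF fin] by simp
  then have "x + y = (\<Sum>n\<in>?N. homog_part gr x n + homog_part gr y n)"
    by (simp only: sum.distrib)
  then have "homog_part gr (x + y) = (\<lambda>n. homog_part gr x n + homog_part gr y n)"
    using subspace_add[OF gr_subspace] homog_part_props(1) fin
    by (intro homog_part_eqI[of _ ?N]) auto
  then show ?thesis by simp
qed

lemma homog_part_sum: "homog_part gr (\<Sum>i\<in>I. f i) n = (\<Sum>i\<in>I. homog_part gr (f i) n)"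
  by (induction I rule: infinite_finite_induct) (simp_all add: homog_part_add homog_part_0)

text \<open>The differentials multiply coefficients on the right by homogeneous matrix entries; this
  is the rule by which they are split into degrees.\<close>

lemma homog_part_mult_right:
  assumes "b \<in> gr q"
  shows "homog_part gr (a * b) n = (if n < q then 0 else homog_part gr a (n - q) * b)"
proof -
  let ?N = "{n. homog_part gr a n \<noteq> 0}" and ?f = "\<lambda>n. if n < q then 0 else homog_part gr a (n - q) * b"
  have fin: "finite ?N" using homog_part_props(2) by simp
  have "homog_part gr (a * b) = ?f"
  proof (rule homog_part_eqI[of _ "(\<lambda>n. n + q) ` ?N"])
    fix n
    show "?f n \<in> gr n"
      using zero_in_gr gr_mult[OF homog_part_props(1)[of a "n - q"] assms] by auto
  next
    fix n assume n: "n \<notin> (\<lambda>n. n + q) ` ?N"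
    show "?f n = 0"
    proof (cases "n < q")
      case False
      then have "n = (n - q) + q" by simp
      then have "n - q \<notin> ?N" using n by blast
      then show ?thesis by simp
    qed simp
  next
    have "a * b = (\<Sum>n\<in>?N. homog_part gr a n) * b" using homog_part_props(3)[of a] by simp
    also have "\<dots> = (\<Sum>n\<in>?N. homog_part gr a n * b)" by (rule sum_distrib_right)
    also have "\<dots> = (\<Sum>n\<in>(\<lambda>n. n + q) ` ?N. ?f n)"
      by (subst sum.reindex) (auto intro!: sum.cong simp: inj_on_def)
    finally show "a * b = (\<Sum>n\<in>(\<lambda>n. n + q) ` ?N. ?f n)" .
  qed (use fin in simp)
  then show ?thesis by simp
qed

lemma augmentation_scale_one: "augmentation scale gr (scale c 1) = c"
proof -
  have "homog_part gr (scale c 1) 0 = scale c 1"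
    using homog_part_homog[of "scale c 1" 0 0] gr_connected by auto
  then show ?thesis unfolding augmentation_def
    by (auto intro!: the_equality simp: scale_cancel_right)
qed

text \<open>For a homogeneous right factor of degree q, the component of degree 0 of the product
  vanishes if q > 0 and has the component of \<open>a\<close> in degree 0 as a factor if q =
  0.\<close>

lemma mult_in_augmentation_ideal:
  assumes "a \<in> augmentation_ideal gr" shows "a * b \<in> augmentation_ideal gr"
proof -
  have "a * b = (\<Sum>n | homog_part gr b n \<noteq> 0. a * homog_part gr b n)"
    using homog_part_props(3)[of b] sum_distrib_left[of a "homog_part gr b"] by metis
  then have "homog_part gr (a * b) 0 =
      (\<Sum>n | homog_part gr b n \<noteq> 0. homog_part gr (a * homog_part gr b n) 0)"
    by (metis homog_part_sum)
  also have "\<dots> = 0"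
    using assms homog_part_mult_right[OF homog_part_props(1)]
    by (intro sum.neutral ballI) (simp add: augmentation_ideal_def)
  finally show ?thesis by (simp add: augmentation_ideal_def)
qed

lemma homog_part_uminus: "homog_part gr (- x) n = - homog_part gr x n"
  using homog_part_add[of x "- x" n] homog_part_0[of n] by (simp add: add_eq_0_iff)

text \<open>In degree 0 there are only scalars and in negative degrees only 0. Applied to matrix
  entries this is the way minimality is exploited.\<close>

lemma gr_int_augmentation_ideal:
  assumes "u \<in> gr_int gr q" "q \<le> 0" "u \<in> augmentation_ideal gr" shows "u = 0"
  using assms homog_part_homog[of u 0 0]
  by (auto simp: gr_int_def augmentation_ideal_def split: if_splits)

end

section \<open>The filtration by word length\<close>

locale generated_graded_algebra = connected_graded_algebra +
  fixes S
  assumes finite_S: "finite S" and S_gr: "S \<subseteq> gr 1" and S_gen: "generated_by scale S"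
begin

definition filt :: "nat \<Rightarrow> 'b set" where
  "filt n = span {prod_list xs | xs. set xs \<subseteq> S \<and> length xs \<le> n}"

text \<open>The counterpart of \<open>filt\<close> for exact length, later identified with
  \<open>gr n\<close>; it makes the homogeneous components finite-dimensional.\<close>

definition word_space :: "nat \<Rightarrow> 'b set" where
  "word_space n = span {prod_list xs | xs. set xs \<subseteq> S \<and> length xs = n}"

lemma filt_finite: "\<exists>B. finite B \<and> filt n = span B"
  unfolding filt_def
  using finite_imageI[OF finite_lists_length_le[OF finite_S], of prod_list n]
  by (intro exI[of _ "{prod_list xs | xs. set xs \<subseteq> S \<and> length xs \<le> n}"])
    (simp add: setcompr_eq_image)

lemma word_space_finite: "\<exists>B. finite B \<and> word_space n = span B"
  unfolding word_space_def
  using finite_imageI[OF finite_lists_length_eq[OF finite_S], of prod_list n]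
  by (intro exI[of _ "{prod_list xs | xs. set xs \<subseteq> S \<and> length xs = n}"])
    (simp add: setcompr_eq_image)

lemma subspace_filt: "subspace (filt n)"
  unfolding filt_def by (rule subspace_span)

lemma filt_mono: "m \<le> n \<Longrightarrow> filt m \<subseteq> filt n"
  unfolding filt_def by (rule span_mono) (auto intro: order_trans)

lemma one_in_filt: "1 \<in> filt n"
  unfolding filt_def by (rule span_base) (auto intro!: exI[of _ "[]"])

lemma filt_mult:
  assumes "a \<in> filt m" "b \<in> filt n" shows "a * b \<in> filt (m + n)"
proof -
  have word: "prod_list xs * b \<in> filt (m + n)" if xs: "set xs \<subseteq> S" "length xs \<le> m" for xs
  proof -
    have "b \<in> span {prod_list xs | xs. set xs \<subseteq> S \<and> length xs \<le> n}" using assms(2) by (simp add: filt_def)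
    then show ?thesis
    proof (induction rule: span_induct_alt)
      case base then show ?case using subspace_0[OF subspace_filt] by simp
    next
      case (step c u v)
      then obtain ys where ys: "u = prod_list ys" "set ys \<subseteq> S" "length ys \<le> n" by auto
      have "prod_list (xs @ ys) \<in> filt (m + n)" unfolding filt_def
        using xs ys by (intro span_base CollectI exI[of _ "xs @ ys"]) auto
      then show ?case using step ys
        by (simp add: distrib_left scale_mult_right subspace_add[OF subspace_filt] subspace_scale[OF subspace_filt])
    qed
  qed
  have "a \<in> span {prod_list xs | xs. set xs \<subseteq> S \<and> length xs \<le> m}" using assms(1) by (simp add: filt_def)
  then show ?thesis
  proof (induction rule: span_induct_alt)
    case base then show ?case using subspace_0[OF subspace_filt] by simp
  next
    case (step c u v)
    then have "u * b \<in> filt (m + n)" using word by auto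
    then show ?case using step
      by (simp add: distrib_right scale_mult_left subspace_add[OF subspace_filt] subspace_scale[OF subspace_filt])
  qed
qed

lemma filt_exhausts: "\<exists>n. a \<in> filt n"
proof -
  have "a \<in> span {prod_list xs | xs. set xs \<subseteq> S}" using S_gen by (simp add: generated_by_def)
  then show ?thesis
  proof (induction rule: span_induct_alt)
    case base then show ?case using subspace_0[OF subspace_filt] by blast
  next
    case (step c u v)
    then obtain n xs where n: "v \<in> filt n" and xs: "u = prod_list xs" "set xs \<subseteq> S" by auto
    have "u \<in> filt (length xs)" unfolding filt_def using xs by (intro span_base) auto
    then have "u \<in> filt (max n (length xs))" "v \<in> filt (max n (length xs))"
      using n filt_mono by (meson max.cobounded1 max.cobounded2 subsetD)+
    then show ?case using subspace_add[OF subspace_filt] subspace_scale[OF subspace_filt] by blast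
  qed
qed

lemma filt_exhausts_finite:
  assumes "finite X" shows "\<exists>n. X \<subseteq> filt n"
  using assms
proof induction
  case (insert a X)
  then obtain m n where "X \<subseteq> filt m" "a \<in> filt n" using filt_exhausts by blast
  then have "insert a X \<subseteq> filt (max m n)" using filt_mono[of m "max m n"] filt_mono[of n "max m n"] by auto
  then show ?case by blast
qed simp

lemma dim_filt_pos: "dim (filt n) > 0"
proof -
  obtain B where B: "finite B" "filt n = span B" using filt_finite by blast
  have "independent {1::'b}" by (simp add: dependent_single)
  then have "dim {1::'b} = 1" using dim_eq_card_independent by fastforce
  moreover have "dim {1::'b} \<le> dim (filt n)"
    using one_in_filt B by (intro dim_mono_spanned[of _ _ B]) (auto intro: span_base)
  ultimately show ?thesis by simp
qed

lemma word_power: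
  assumes "set xs \<subseteq> filt s" shows "prod_list xs \<in> filt (length xs * s)"
  using assms
proof (induction xs)
  case Nil then show ?case by (simp add: one_in_filt)
next
  case (Cons a xs) then show ?case using filt_mult[of a s "prod_list xs" "length xs * s"] by simp
qed

text \<open>\<open>span S\<close> is one of the subspaces over which \<open>GKdim\<close> takes the
  supremum, and the sum of its powers up to n is \<open>filt n\<close>. So the limsup of the
  logarithms lies below some natural number \<open>K\<close>, which is then an exponent bounding the
  growth.\<close>

lemma polynomial_growth:
  assumes "GKdim scale < \<infinity>"
  obtains K where "eventually (\<lambda>n. real (dim (filt n)) \<le> real n ^ K) sequentially"
proof -
  have S1: "span S \<subseteq> filt 1"
    unfolding filt_def by (intro span_mono) (auto intro!: exI[of _ "[_]"])
  have eq: "span {prod_list xs | xs. set xs \<subseteq> span S \<and> length xs \<le> n} = filt n" for n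
  proof (intro equalityI)
    show "filt n \<subseteq> span {prod_list xs | xs. set xs \<subseteq> span S \<and> length xs \<le> n}"
      unfolding filt_def by (intro span_mono) (use span_superset in blast)
    have "prod_list xs \<in> filt n" if "set xs \<subseteq> span S" "length xs \<le> n" for xs
      using word_power[of xs 1] that S1 filt_mono[of "length xs" n] by auto
    then show "span {prod_list xs | xs. set xs \<subseteq> span S \<and> length xs \<le> n} \<subseteq> filt n"
      by (intro span_minimal subspace_filt) auto
  qed
  have "limsup (\<lambda>n. ereal (log (real n) (real (dim (filt n))))) \<le> GKdim scale"
    unfolding GKdim_def eq[symmetric] using finite_S by (intro SUP_upper) blast
  then have "limsup (\<lambda>n. ereal (log (real n) (real (dim (filt n))))) \<noteq> \<infinity>" using assms by auto
  then obtain K :: nat where "limsup (\<lambda>n. ereal (log (real n) (real (dim (filt n))))) < ereal (real K)"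
    unfolding less_PInf_Ex_of_nat ..
  then have "eventually (\<lambda>n. ereal (log (real n) (real (dim (filt n)))) < ereal (real K)) sequentially"
    by (rule Limsup_lessD)
  then have "eventually (\<lambda>n. real (dim (filt n)) \<le> real n ^ K) sequentially"
    using eventually_ge_at_top[of 2]
  proof eventually_elim
    case (elim n)
    then have "real (dim (filt n)) < real n powr real K"
      using dim_filt_pos[of n] by (simp add: log_less_iff)
    then show ?case using elim by (simp add: powr_realpow)
  qed
  then show ?thesis using that by blast
qed

text \<open>
  The proof compares the dimension of \<open>r\<close> copies of the filtration step \<open>n\<close> with that of \<open>s\<close>
  copies of the step \<open>n + D\<close>; for \<open>r > s\<close> this would force exponential growth.
\<close>

theorem independent_rows_le:
  fixes v :: "nat \<Rightarrow> nat \<Rightarrow> 'b"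
  assumes GK: "GKdim scale < \<infinity>"
    and indep: "\<And>c. (\<And>j. j < s \<Longrightarrow> (\<Sum>i<r. c i * v i j) = 0) \<Longrightarrow> (\<And>i. i < r \<Longrightarrow> c i = 0)"
  shows "r \<le> s"
proof (rule ccontr)
  assume "\<not> r \<le> s" then have rs: "s + 1 \<le> r" by simp
  have "finite ((\<lambda>(i, j). v i j) ` ({..<r} \<times> {..<s}))" by simp
  then obtain D0 where D0: "(\<lambda>(i, j). v i j) ` ({..<r} \<times> {..<s}) \<subseteq> filt D0"
    using filt_exhausts_finite by blast
  \<comment> \<open>The shift makes \<open>D\<close> positive, as needed for the \<open>D\<close>-th
    root and for \<open>N \<le> (N + 1) * D\<close> below.\<close>
  define D where "D = D0 + 1"
  have vD: "v i j \<in> filt D" if "i < r" "j < s" for i j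
    using D0 that filt_mono[of D0 D] by (auto simp: D_def)
  interpret seq: vector_space "seq_scale scale" by (rule vector_space_seq)
  interpret pp: vector_space_pair "seq_scale scale" "seq_scale scale" by unfold_locales
  define f where "f c = (\<lambda>j. if j < s then \<Sum>i<r. c i * v i j else 0)" for c
  have lin: "Vector_Spaces.linear (seq_scale scale) (seq_scale scale) f"
    by unfold_locales
      (auto simp: f_def seq_scale_def fun_eq_iff distrib_right sum.distrib scale_mult_left scale_sum_right)
  have step: "r * dim (filt n) \<le> s * dim (filt (n + D))" for n
  proof -
    have box: "(\<exists>B. finite B \<and> seq_box q (\<lambda>_. filt m) \<subseteq> seq.span B) \<and>
        seq.dim (seq_box q (\<lambda>_. filt m)) = q * dim (filt m)" for q m
    proof -
      have "\<exists>B. finite B \<and> filt m \<subseteq> span B" using filt_finite[of m] by auto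
      then show ?thesis using dim_seq_box[of q "\<lambda>_. filt m"] subspace_filt by simp
    qed
    obtain B where B: "finite B" "seq_box r (\<lambda>_. filt n) \<subseteq> seq.span B" using box by blast
    obtain C where C: "finite C" "seq_box s (\<lambda>_. filt (n + D)) \<subseteq> seq.span C" using box by blast
    have "seq.subspace (seq_box r (\<lambda>_. filt n))" by (rule subspace_seq_box) (rule subspace_filt)
    then have "r * dim (filt n) = seq.dim (f ` seq_box r (\<lambda>_. filt n))
        + seq.dim {x \<in> seq_box r (\<lambda>_. filt n). f x = 0}"
      using pp.rank_nullity[OF lin _ B(2,1)] box by simp
    moreover have "{x \<in> seq_box r (\<lambda>_. filt n). f x = 0} \<subseteq> {0}"
    proof
      fix x assume x: "x \<in> {x \<in> seq_box r (\<lambda>_. filt n). f x = 0}"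
      then have "(\<Sum>i<r. x i * v i j) = 0" if "j < s" for j
        using that by (auto simp: f_def fun_eq_iff split: if_splits)
      then have "x i = 0" for i using indep[of x] x by (cases "i < r") (auto simp: seq_box_def)
      then show "x \<in> {0}" by auto
    qed
    then have "seq.dim {x \<in> seq_box r (\<lambda>_. filt n). f x = 0} = 0" by (rule seq.dim_eq_0_spanned)
    moreover have "f ` seq_box r (\<lambda>_. filt n) \<subseteq> seq_box s (\<lambda>_. filt (n + D))"
      using vD by (auto simp: f_def seq_box_def intro!: subspace_sum[OF subspace_filt] filt_mult)
    then have "seq.dim (f ` seq_box r (\<lambda>_. filt n)) \<le> seq.dim (seq_box s (\<lambda>_. filt (n + D)))"
      using C seq.span_superset by (intro seq.dim_mono_spanned[OF _ C(2,1)]) blast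
    ultimately show ?thesis using box by simp
  qed
  \<comment> \<open>For \<open>s = 0\<close> the comparison at \<open>n = 0\<close> would read
    \<open>r * dim (filt 0) \<le> 0\<close>.\<close>
  have spos: "s > 0" using step[of 0] dim_filt_pos[of 0] rs by (cases s) auto
  define q where "q = (real s + 1) / real s"
  have q: "q > 1" using spos by (simp add: q_def)
  have grow: "q * real (dim (filt n)) \<le> real (dim (filt (n + D)))" for n
  proof -
    have "(s + 1) * dim (filt n) \<le> s * dim (filt (n + D))"
      using step[of n] mult_le_mono1[OF rs, of "dim (filt n)"] by linarith
    then have "real ((s + 1) * dim (filt n)) \<le> real (s * dim (filt (n + D)))" by (rule of_nat_mono)
    then show ?thesis using spos by (simp add: q_def field_simps)
  qed
  have exp: "q ^ k \<le> real (dim (filt (k * D)))" for k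
  proof (induction k)
    case 0 then show ?case using dim_filt_pos[of 0] by simp
  next
    case (Suc k)
    have "q ^ Suc k \<le> q * real (dim (filt (k * D)))" using Suc q by simp
    also have "\<dots> \<le> real (dim (filt (Suc k * D)))" using grow[of "k * D"] by (simp add: add.commute)
    finally show ?case .
  qed
  \<comment> \<open>The midpoint (1 + q) / 2 lies strictly between 1 and \<open>q\<close>: so
    \<open>c > 1\<close> still outgrows every polynomial, while \<open>c ^ D < q\<close> contradicts
    the growth by the factor \<open>q\<close> in every \<open>D\<close> steps.\<close>
  define c where "c = root D ((1 + q) / 2)"
  have cD: "c ^ D = (1 + q) / 2" unfolding c_def using q by (intro real_root_pow_pos2) (auto simp: D_def)
  have c: "c > 1" unfolding c_def using q by (simp add: D_def)
  obtain K where "eventually (\<lambda>n. real (dim (filt n)) \<le> real n ^ K) sequentially"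
    using polynomial_growth[OF GK] by blast
  then have "eventually (\<lambda>n. real (dim (filt n)) \<le> c ^ n) sequentially"
    using eventually_power_le_exp[OF c, of K] by eventually_elim (rule order_trans)
  then obtain N where N: "\<forall>n\<ge>N. real (dim (filt n)) \<le> c ^ n"
    unfolding eventually_sequentially ..
  have "q ^ (N + 1) \<le> c ^ ((N + 1) * D)"
    by (rule order_trans[OF exp N[rule_format]]) (simp add: D_def)
  also have "\<dots> = ((1 + q) / 2) ^ (N + 1)" by (metis cD mult.commute power_mult)
  also have "\<dots> < q ^ (N + 1)" using q by (intro power_strict_mono) auto
  finally show False by simp
qed

end

section \<open>Gelfand-Kirillov dimension and the Hilbert series\<close>

context generated_graded_algebra
begin

lemma word_in_gr: "set xs \<subseteq> S \<Longrightarrow> prod_list xs \<in> gr (length xs)"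
proof (induction xs)
  case Nil
  have "1 = scale 1 1" by simp
  then show ?case using gr_connected by (metis list.size(3) prod_list.Nil rangeI)
next
  case (Cons x xs)
  then show ?case using S_gr gr_mult[of x 1 "prod_list xs" "length xs"] by auto
qed

text \<open>A word is homogeneous of degree its length, so taking the component of degree
  \<open>n\<close> of a combination of words keeps exactly the words of length
  \<open>n\<close>.\<close>

lemma word_space_eq_gr: "word_space n = gr n"
proof (intro equalityI subsetI)
  fix a assume "a \<in> word_space n"
  moreover have "word_space n \<subseteq> gr n"
    unfolding word_space_def by (rule span_minimal[OF _ gr_subspace]) (use word_in_gr in auto)
  ultimately show "a \<in> gr n" by blast
next
  have sub: "subspace (word_space m)" for m unfolding word_space_def by (rule subspace_span)
  fix a assume a: "a \<in> gr n"
  have "a \<in> span {prod_list xs | xs. set xs \<subseteq> S}" using S_gen by (simp add: generated_by_def)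
  then have "\<forall>m. homog_part gr a m \<in> word_space m"
  proof (induction rule: span_induct_alt)
    case base then show ?case using subspace_0[OF sub] by (simp add: homog_part_0)
  next
    case (step c u v)
    then obtain xs where xs: "u = prod_list xs" "set xs \<subseteq> S" by auto
    have u: "scale c u \<in> gr (length xs)" using word_in_gr[OF xs(2)] xs(1) subspace_scale[OF gr_subspace] by simp
    have "u \<in> word_space (length xs)" unfolding word_space_def using xs by (intro span_base) auto
    then have w: "scale c u \<in> word_space (length xs)" by (rule subspace_scale[OF sub])
    show ?case
    proof
      fix m
      have "homog_part gr (scale c u) m \<in> word_space m"
        using homog_part_homog[OF u, of m] w subspace_0[OF sub, of m] by (cases "m = length xs") simp_all
      then show "homog_part gr (scale c u + v) m \<in> word_space m"
        using step(2) subspace_add[OF sub] by (simp add: homog_part_add)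
    qed
  qed
  then show "a \<in> word_space n" using homog_part_homog[OF a, of n] by (metis (full_types))
qed

lemma gr_finite: "\<exists>B. finite B \<and> gr n = span B"
  using word_space_finite word_space_eq_gr by metis

lemma dim_gr_le_filt: "dim (gr n) \<le> dim (filt n)"
proof -
  obtain B where "finite B" "filt n = span B" using filt_finite by blast
  moreover have "gr n \<subseteq> filt n"
    unfolding word_space_eq_gr[symmetric] word_space_def filt_def by (rule span_mono) auto
  ultimately show ?thesis using span_superset[of "filt n"] by (intro dim_mono_spanned[of _ _ B]) auto
qed

text \<open>The union of bases of the \<open>gr i\<close> with \<open>i \<le> n\<close> spans
  \<open>filt n\<close>, since each word lies in the component of its length.\<close>

lemma dim_filt_le: "dim (filt n) \<le> (\<Sum>i\<le>n. dim (gr i))"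
proof -
  have "\<exists>C. finite C \<and> gr i \<subseteq> span C \<and> card C = dim (gr i)" for i
  proof -
    obtain C where C: "C \<subseteq> gr i" "independent C" "gr i \<subseteq> span C" "card C = dim (gr i)"
      using basis_exists by blast
    obtain B where B: "finite B" "gr i = span B" using gr_finite by blast
    have "finite C" using finite_independent_in_span[OF C(2,1) _ B(1)] B(2) by simp
    then show ?thesis using C by blast
  qed
  then obtain C where C: "\<And>i. finite (C i)" "\<And>i. gr i \<subseteq> span (C i)" "\<And>i. card (C i) = dim (gr i)"
    by metis
  have "filt n \<subseteq> span (\<Union>i\<le>n. C i)"
    unfolding filt_def
  proof (rule span_minimal[OF _ subspace_span], rule subsetI)
    fix a assume "a \<in> {prod_list xs | xs. set xs \<subseteq> S \<and> length xs \<le> n}"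
    then obtain xs where xs: "a = prod_list xs" "set xs \<subseteq> S" "length xs \<le> n" by auto
    have "a \<in> span (C (length xs))" using word_in_gr[OF xs(2)] xs(1) C(2) by auto
    then show "a \<in> span (\<Union>i\<le>n. C i)" using span_mono[of "C (length xs)" "\<Union>i\<le>n. C i"] xs(3) by blast
  qed
  then have "dim (filt n) \<le> card (\<Union>i\<le>n. C i)" using C(1) by (intro dim_le_card) auto
  also have "\<dots> \<le> (\<Sum>i\<le>n. card (C i))" by (rule card_UN_le) simp
  finally show ?thesis using C(3) by simp
qed

text \<open>With c = 1 / sqrt t > 1 the coefficients are eventually at most c^n, so the terms are
  dominated by the geometric series of c t = sqrt t.\<close>

lemma hilbert_series_summable:
  assumes GK: "GKdim scale < \<infinity>" and t: "0 < t" "t < (1::real)"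
  shows "summable (\<lambda>n. real (dim (gr n)) * t ^ n)"
proof -
  obtain K where K: "eventually (\<lambda>n. real (dim (filt n)) \<le> real n ^ K) sequentially"
    using polynomial_growth[OF GK] by blast
  define c where "c = 1 / sqrt t"
  have c: "c > 1" using t by (simp add: c_def)
  have ct: "c * t = sqrt t" using t by (simp add: c_def real_div_sqrt)
  have "eventually (\<lambda>n. norm (real (dim (gr n)) * t ^ n) \<le> sqrt t ^ n) sequentially"
    using K eventually_power_le_exp[OF c, of K]
  proof eventually_elim
    case (elim n)
    have "real (dim (gr n)) \<le> c ^ n" using elim dim_gr_le_filt[of n] by linarith
    then have "real (dim (gr n)) * t ^ n \<le> c ^ n * t ^ n" using t by (intro mult_right_mono) auto
    also have "\<dots> = sqrt t ^ n" by (metis ct power_mult_distrib)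
    finally show ?case using t by simp
  qed
  then show ?thesis
    by (rule summable_comparison_test_ev) (use t in \<open>simp add: summable_geometric\<close>)
qed

text \<open>A finite-dimensional \<open>V\<close> lies in some \<open>filt s\<close>, and products
  of at most n of its elements lie in \<open>filt (n * s)\<close>. The factor s^m and the constant
  \<open>C\<close> contribute only a term ln C' / ln n to the logarithm, which tends to 0.\<close>

lemma GKdim_le_of_filt:
  assumes "eventually (\<lambda>n. real (dim (filt n)) \<le> C * real n ^ m) sequentially"
  shows "GKdim scale \<le> ereal (real m)"
  unfolding GKdim_def
proof (rule SUP_least)
  fix V assume "V \<in> {span T | T. finite T}"
  then obtain T where T: "finite T" "V = span T" by blast
  obtain s0 where "T \<subseteq> filt s0" using filt_exhausts_finite[OF T(1)] by blast
  then have "T \<subseteq> filt (s0 + 1)" using filt_mono[of s0 "s0 + 1"] by auto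
  then obtain s where s: "s \<ge> 1" "V \<subseteq> filt s"
    using span_minimal[OF _ subspace_filt] T(2) by (metis le_add2)
  let ?W = "\<lambda>n. span {prod_list xs | xs. set xs \<subseteq> V \<and> length xs \<le> n}"
  \<comment> \<open>The absolute value and the 1 make the constant positive, so that its logarithm
    may be taken.\<close>
  define C' where "C' = (\<bar>C\<bar> + 1) * real s ^ m"
  have C': "C' > 0" using s(1) unfolding C'_def by (intro mult_pos_pos) auto
  have W: "?W n \<subseteq> filt (n * s)" for n
  proof (rule span_minimal[OF _ subspace_filt], rule subsetI)
    fix a assume "a \<in> {prod_list xs | xs. set xs \<subseteq> V \<and> length xs \<le> n}"
    then obtain xs where xs: "a = prod_list xs" "set xs \<subseteq> V" "length xs \<le> n" by auto
    have "a \<in> filt (length xs * s)" using word_power[of xs s] xs s(2) by auto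
    then show "a \<in> filt (n * s)" using filt_mono[of "length xs * s" "n * s"] xs(3) by auto
  qed
  have dimW: "dim (?W n) \<le> dim (filt (n * s))" for n
  proof -
    obtain B where "finite B" "filt (n * s) = span B" using filt_finite by blast
    then show ?thesis using W[of n] span_superset[of "filt (n * s)"]
      by (intro dim_mono_spanned[of _ _ B]) (auto intro: order_trans)
  qed
  have "filterlim (\<lambda>n. n * s) at_top sequentially"
    using s(1) by (intro mult_nat_right_at_top) auto
  from eventually_compose_filterlim[OF assms this]
  have "eventually (\<lambda>n. real (dim (filt (n * s))) \<le> C * real (n * s) ^ m) sequentially" .
  then have "eventually (\<lambda>n. ereal (log (real n) (real (dim (?W n)))) \<le> ereal (ln C' / ln (real n) + real m)) sequentially"
    using eventually_ge_at_top[of "2 + nat \<lceil>1 / C'\<rceil>"]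
  proof eventually_elim
    case (elim n)
    then have n2: "n \<ge> 2" by simp
    have "real n \<ge> 1 / C'" using elim(2) by linarith
    then have nC: "1 \<le> C' * real n" using C' by (simp add: field_simps)
    have "C * real (n * s) ^ m \<le> (\<bar>C\<bar> + 1) * real (n * s) ^ m" by (intro mult_right_mono) auto
    also have "\<dots> = C' * real n ^ m" by (simp add: C'_def power_mult_distrib)
    finally have le: "real (dim (?W n)) \<le> C' * real n ^ m" using dimW[of n] elim(1) by linarith
    have "1 \<in> ?W n" by (rule span_base) (auto intro!: exI[of _ "[]"])
    have "dim (?W n) > 0"
    proof -
      obtain B where B: "finite B" "filt (n * s) = span B" using filt_finite by blast
      have "independent {1::'b}" by (simp add: dependent_single)
      then have "dim {1::'b} = 1" using dim_eq_card_independent by fastforce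
      moreover have "dim {1::'b} \<le> dim (?W n)"
        using \<open>1 \<in> ?W n\<close> B W[of n] by (intro dim_mono_spanned[of _ _ B]) (auto intro: span_base)
      ultimately show ?thesis by simp
    qed
    then have "ln (real (dim (?W n))) \<le> ln (C' * real n ^ m)" using le C' n2 by (subst ln_le_cancel_iff) auto
    also have "\<dots> = ln C' + real m * ln (real n)" using C' n2 by (simp add: ln_mult ln_realpow)
    finally have "log (real n) (real (dim (?W n))) \<le> (ln C' + real m * ln (real n)) / ln (real n)"
      using n2 unfolding log_def by (intro divide_right_mono) auto
    also have "\<dots> = ln C' / ln (real n) + real m" using n2 by (simp add: add_divide_distrib)
    finally show ?case by simp
  qed
  then have "limsup (\<lambda>n. ereal (log (real n) (real (dim (?W n))))) \<le> limsup (\<lambda>n. ereal (ln C' / ln (real n) + real m))"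
    by (rule Limsup_mono)
  also have "(\<lambda>n. ln C' / ln (real n) + real m) \<longlonglongrightarrow> 0 + real m"
    by (intro tendsto_add tendsto_const tendsto_divide_0[OF tendsto_const]
        filterlim_at_top_imp_at_infinity filterlim_compose[OF ln_at_top filterlim_real_sequentially])
  then have "limsup (\<lambda>n. ereal (ln C' / ln (real n) + real m)) = ereal (real m)"
    by (intro lim_imp_Limsup) simp_all
  finally show "limsup (\<lambda>n. ereal (log (real n) (real (dim (?W n))))) \<le> ereal (real m)" .
qed

text \<open>
  A Tauberian bound: evaluating the Hilbert series at \<open>1 - 1 / n\<close> bounds the sum of its first \<open>n\<close>
  coefficients by a multiple of \<open>n\<close> to the pole order at \<open>1\<close>.
\<close>

theorem GKdim_le_order:
  fixes F :: "real poly"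
  assumes GK: "GKdim scale < \<infinity>"
    and F: "\<And>t. 0 < t \<Longrightarrow> t < 1 \<Longrightarrow> poly F t * (\<Sum>n. real (dim (gr n)) * t ^ n) = 1"
  shows "GKdim scale \<le> ereal (real (order 1 F))"
proof -
  have "F \<noteq> 0" using F[of "1/2"] by auto
  define m where "m = order 1 F"
  obtain q where q: "F = [:-1, 1:] ^ m * q" "\<not> [:-1, 1:] dvd q"
    using order_decomp[OF \<open>F \<noteq> 0\<close>, of 1] m_def by auto
  have q1: "\<bar>poly q 1\<bar> > 0" using q(2) by (simp add: poly_eq_0_iff_dvd)
  have lim1: "(\<lambda>n. 1 - 1 / real n) \<longlonglongrightarrow> 1 - 0"
    by (intro tendsto_diff tendsto_const lim_1_over_n)
  have "(\<lambda>n. \<bar>poly q (1 - 1 / real n)\<bar>) \<longlonglongrightarrow> \<bar>poly q 1\<bar>"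
    using lim1 by (intro tendsto_rabs tendsto_poly) simp
  then have ev1: "eventually (\<lambda>n. \<bar>poly q (1 - 1 / real n)\<bar> > \<bar>poly q 1\<bar> / 2) sequentially"
    using q1 by (intro order_tendstoD(1)) auto
  have "(\<lambda>n. (1 + (- 1) / real n) ^ n) \<longlonglongrightarrow> exp (- 1)" by (rule tendsto_exp_limit_sequentially)
  then have ev2: "eventually (\<lambda>n. (1 + (- 1) / real n) ^ n > exp (- 1) / 2) sequentially"
    by (rule order_tendstoD(1)) simp
  \<comment> \<open>Two factors 2 are lost: one in bounding q(t) below by half of its limit q(1),
    the other in bounding t^n below by half of its limit exp (-1).\<close>
  define C where "C = 4 / (exp (- 1) * \<bar>poly q 1\<bar>)"
  have "eventually (\<lambda>n. real (dim (filt n)) \<le> C * real n ^ m) sequentially"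
    using ev1 ev2 eventually_ge_at_top[of 2]
  proof eventually_elim
    case (elim n)
    define t where "t = 1 - 1 / real n"
    define e :: real where "e = exp (- 1)"
    have e: "e > 0" by (simp add: e_def)
    have t: "0 < t" "t < 1" using elim(3) by (auto simp: t_def)
    let ?h = "\<lambda>i. real (dim (gr i))"
    have sm: "summable (\<lambda>i. ?h i * t ^ i)" by (rule hilbert_series_summable[OF GK t])
    have tn: "t ^ n > e / 2" using elim(2) by (simp add: t_def e_def)
    have "(\<Sum>i\<le>n. ?h i) * t ^ n = (\<Sum>i\<le>n. ?h i * t ^ n)" by (rule sum_distrib_right)
    also have "\<dots> \<le> (\<Sum>i\<le>n. ?h i * t ^ i)"
      using t by (intro sum_mono mult_left_mono power_decreasing) auto
    also have "\<dots> \<le> (\<Sum>i. ?h i * t ^ i)"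
      using t by (intro sum_le_suminf[OF sm]) auto
    also have "\<dots> = 1 / \<bar>poly F t\<bar>"
    proof -
      have pos: "(\<Sum>i. ?h i * t ^ i) \<ge> 0" using t by (intro suminf_nonneg[OF sm]) auto
      have "\<bar>poly F t\<bar> * \<bar>\<Sum>i. ?h i * t ^ i\<bar> = 1" using F[OF t] by (metis abs_mult abs_one)
      then show ?thesis using pos by (metis abs_of_nonneg nonzero_eq_divide_eq mult.commute mult_zero_left zero_neq_one)
    qed
    \<comment> \<open>Here t - 1 = -1/n, so the factor (t - 1)^m has absolute value n^(-m).\<close>
    also have "\<bar>poly F t\<bar> = \<bar>poly q t\<bar> / real n ^ m"
      using elim(3) by (simp add: q(1) abs_mult power_abs t_def power_one_over divide_simps)
    also have "1 / (\<bar>poly q t\<bar> / real n ^ m) \<le> 2 * real n ^ m / \<bar>poly q 1\<bar>"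
    proof -
      have a: "\<bar>poly q t\<bar> > \<bar>poly q 1\<bar> / 2" using elim(1) by (simp add: t_def)
      then have "real n ^ m / \<bar>poly q t\<bar> \<le> real n ^ m / (\<bar>poly q 1\<bar> / 2)"
        using q1 by (intro divide_left_mono) auto
      then show ?thesis by (simp add: mult.commute)
    qed
    finally have 1: "(\<Sum>i\<le>n. ?h i) * t ^ n \<le> 2 * real n ^ m / \<bar>poly q 1\<bar>" .
    have "real (dim (filt n)) * (e / 2) \<le> (\<Sum>i\<le>n. ?h i) * t ^ n"
      using dim_filt_le[of n] tn e
      by (intro mult_mono) (auto simp flip: of_nat_sum intro: sum_nonneg)
    with 1 have "real (dim (filt n)) * (e / 2) \<le> 2 * real n ^ m / \<bar>poly q 1\<bar>" by linarith
    then have "real (dim (filt n)) \<le> (2 * real n ^ m / \<bar>poly q 1\<bar>) / (e / 2)"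
      using e by (subst pos_le_divide_eq) auto
    also have "\<dots> = C * real n ^ m" by (simp add: C_def e_def mult.commute)
    finally show ?case .
  qed
  then show ?thesis unfolding m_def by (rule GKdim_le_of_filt)
qed

end

section \<open>Minimal free resolutions\<close>

definition unit_seq :: "nat \<Rightarrow> nat \<Rightarrow> 'a::ring_1" where
  "unit_seq j = (\<lambda>i. if i = j then 1 else 0)"

definition free_carrier :: "nat \<Rightarrow> (nat \<Rightarrow> 'a::ring_1) set" where
  "free_carrier r = {v. \<forall>i\<ge>r. v i = 0}"

lemma unit_seq_free_carrier: "j < r \<Longrightarrow> unit_seq j \<in> free_carrier r"
  by (simp add: unit_seq_def free_carrier_def)

lemma gfree_simps:
  "carrier (gfree gr ds) = free_carrier (length ds)"
  "\<zero>\<^bsub>gfree gr ds\<^esub> = (\<lambda>_. 0)"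
  "v \<oplus>\<^bsub>gfree gr ds\<^esub> w = (\<lambda>i. v i + w i)"
  "a \<odot>\<^bsub>gfree gr ds\<^esub> v = (\<lambda>i. a * v i)"
  by (simp_all add: gfree_def free_carrier_def)

lemma gcomp_gfree:
  "gcomp (gfree gr ds) n = seq_box (length ds) (\<lambda>i. gr_int gr (n - ds ! i))"
  by (auto simp: gfree_def seq_box_def)

lemma lmod_homD:
  assumes "f \<in> lmod_hom M N"
  shows "x \<in> carrier M \<Longrightarrow> f x \<in> carrier N"
    and "x \<in> carrier M \<Longrightarrow> y \<in> carrier M \<Longrightarrow> f (x \<oplus>\<^bsub>M\<^esub> y) = f x \<oplus>\<^bsub>N\<^esub> f y"
    and "x \<in> carrier M \<Longrightarrow> f (a \<odot>\<^bsub>M\<^esub> x) = a \<odot>\<^bsub>N\<^esub> f x"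
  using assms by (auto simp: lmod_hom_def hom_def)

text \<open>Truncations of \<open>v\<close> grow by one multiple of a basis vector at a time. By
  left linearity the coefficients stay on the left, so the map is right multiplication by a
  matrix.\<close>

lemma free_linear_expansion:
  fixes f :: "(nat \<Rightarrow> 'a::ring_1) \<Rightarrow> 'a"
  assumes add: "\<And>v w. v \<in> free_carrier r \<Longrightarrow> w \<in> free_carrier r \<Longrightarrow> f (\<lambda>i. v i + w i) = f v + f w"
    and smult: "\<And>a v. v \<in> free_carrier r \<Longrightarrow> f (\<lambda>i. a * v i) = a * f v"
    and v: "v \<in> free_carrier r"
  shows "f v = (\<Sum>j<r. v j * f (unit_seq j))"
proof -
  have "f (\<lambda>i. if i < m then v i else 0) = (\<Sum>j<m. v j * f (unit_seq j))" if "m \<le> r" for m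
    using that
  proof (induction m)
    case 0
    have "f (\<lambda>i. 0 * v i) = 0 * f v" using v by (rule smult)
    then show ?case by simp
  next
    case (Suc m)
    have u: "(unit_seq m :: nat \<Rightarrow> 'a) \<in> free_carrier r" using Suc.prems by (intro unit_seq_free_carrier) simp
    have 1: "(\<lambda>i. if i < m then v i else 0) \<in> free_carrier r" using Suc.prems by (simp add: free_carrier_def)
    have 2: "(\<lambda>i. v m * unit_seq m i) \<in> free_carrier r" using u by (auto simp: free_carrier_def)
    have "(\<lambda>i. if i < Suc m then v i else 0) = (\<lambda>i. (if i < m then v i else 0) + v m * unit_seq m i)"
      by (rule ext) (simp add: unit_seq_def less_Suc_eq)
    then show ?case using add[OF 1 2] smult[OF u] Suc by simp
  qed
  from this[of r] have "f (\<lambda>i. if i < r then v i else 0) = (\<Sum>j<r. v j * f (unit_seq j))" by simp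
  moreover have "(\<lambda>i. if i < r then v i else 0) = v" using v by (intro ext) (simp add: free_carrier_def)
  ultimately show ?thesis by simp
qed

context left_module
begin

lemma smult_zero: "a \<odot> \<zero> = \<zero>"
proof -
  have "a \<odot> \<zero> \<oplus> a \<odot> \<zero> = a \<odot> \<zero>" using smult_add_right[of \<zero> \<zero> a] by simp
  then show ?thesis using smult_closed[of \<zero> a] by (metis add.l_cancel_one' zero_closed)
qed

end

text \<open>Makes \<open>Gorenstein\<close>, which speaks of projective resolutions, applicable to
  the free resolution. The lift sends each basis vector to a chosen preimage.\<close>

lemma projective_gfree:
  fixes gr :: "nat \<Rightarrow> 'a::ring_1 set"
  assumes "left_module (gfree gr ds)"
  shows "projective (gfree gr ds)"
  unfolding projective_def
proof (intro conjI assms allI impI)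
  fix M N :: "('a, nat \<Rightarrow> 'a) module" and g f
  assume M: "left_module M" and N: "left_module N" and g: "g \<in> lmod_hom M N"
    and surj: "g ` carrier M = carrier N" and f: "f \<in> lmod_hom (gfree gr ds) N"
  interpret M: left_module M by (rule M)
  interpret N: left_module N by (rule N)
  let ?r = "length ds"
  note gD = lmod_homD[OF g] and fD = lmod_homD[OF f, unfolded gfree_simps]
  have "\<exists>m. m \<in> carrier M \<and> (j < ?r \<longrightarrow> g m = f (unit_seq j))" for j
  proof (cases "j < ?r")
    case True
    then show ?thesis using fD(1)[OF unit_seq_free_carrier] surj by (metis imageE)
  qed (use M.zero_closed in blast)
  then obtain m where m: "\<And>j. m j \<in> carrier M" "\<And>j. j < ?r \<Longrightarrow> g (m j) = f (unit_seq j)"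
    by metis
  \<comment> \<open>\<open>H k v\<close> is the sum of the first \<open>k\<close> terms
    \<open>v j \<odot> m j\<close>; as a recursion it is additive and linear by induction on
    \<open>k\<close>.\<close>
  define H where "H = (\<lambda>k v. rec_nat \<zero>\<^bsub>M\<^esub> (\<lambda>j y. y \<oplus>\<^bsub>M\<^esub> v j \<odot>\<^bsub>M\<^esub> m j) k)"
  have H0: "H 0 v = \<zero>\<^bsub>M\<^esub>" and HS: "H (Suc k) v = H k v \<oplus>\<^bsub>M\<^esub> v k \<odot>\<^bsub>M\<^esub> m k" for k v
    by (simp_all add: H_def)
  have Hc: "H k v \<in> carrier M" for k v
    by (induction k) (simp_all add: H0 HS m M.smult_closed)
  have Hadd: "H k (\<lambda>i. v i + w i) = H k v \<oplus>\<^bsub>M\<^esub> H k w" for k v w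
    by (induction k) (simp_all add: H0 HS m M.smult_closed M.smult_add_left Hc M.a_ac)
  have Hsm: "H k (\<lambda>i. a * v i) = a \<odot>\<^bsub>M\<^esub> H k v" for k a v
    by (induction k) (simp_all add: H0 HS m M.smult_closed M.smult_add_right Hc M.smult_zero M.smult_assoc)
  have gH: "g (H k v) = f (\<lambda>i. if i < k then v i else 0)" if "k \<le> ?r" "v \<in> free_carrier ?r" for k v
    using that(1)
  proof (induction k)
    case 0
    have "g (0 \<odot>\<^bsub>M\<^esub> \<zero>\<^bsub>M\<^esub>) = 0 \<odot>\<^bsub>N\<^esub> g \<zero>\<^bsub>M\<^esub>" by (rule gD(3)) simp
    moreover have z: "0 \<odot>\<^bsub>N\<^esub> x = \<zero>\<^bsub>N\<^esub>" if "x \<in> carrier N" for x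
    proof -
      have "0 \<odot>\<^bsub>N\<^esub> x \<oplus>\<^bsub>N\<^esub> 0 \<odot>\<^bsub>N\<^esub> x = 0 \<odot>\<^bsub>N\<^esub> x" using N.smult_add_left[OF that, of 0 0] by simp
      then show ?thesis using N.smult_closed[OF that, of 0] by (metis N.add.l_cancel_one')
    qed
    moreover have "f (\<lambda>i. 0 * v i) = 0 \<odot>\<^bsub>N\<^esub> f v" using that(2) by (rule fD(3))
    ultimately show ?case using fD(1)[OF that(2)] gD(1)[OF M.zero_closed] by (simp add: H0 M.smult_zero)
  next
    case (Suc k)
    have u: "(unit_seq k :: nat \<Rightarrow> 'a) \<in> free_carrier ?r" using Suc.prems by (intro unit_seq_free_carrier) simp
    have 1: "(\<lambda>i. if i < k then v i else 0) \<in> free_carrier ?r" using Suc.prems by (simp add: free_carrier_def)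
    have 2: "(\<lambda>i. v k * unit_seq k i) \<in> free_carrier ?r" using u by (auto simp: free_carrier_def)
    have "(\<lambda>i. if i < Suc k then v i else 0) = (\<lambda>i. (if i < k then v i else 0) + v k * unit_seq k i)"
      by (rule ext) (simp add: unit_seq_def less_Suc_eq)
    then have "f (\<lambda>i. if i < Suc k then v i else 0) = g (H k v) \<oplus>\<^bsub>N\<^esub> v k \<odot>\<^bsub>N\<^esub> g (m k)"
      using fD(2)[OF 1 2] fD(3)[OF u] Suc m(2)[of k] by simp
    then show ?case using gD(2)[OF Hc M.smult_closed[OF m(1)]] gD(3)[OF m(1)] by (simp add: HS)
  qed
  have "H ?r \<in> lmod_hom (gfree gr ds) M"
    by (auto simp: lmod_hom_def hom_def gfree_simps Hc Hadd Hsm)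
  moreover have "g (H ?r v) = f v" if "v \<in> free_carrier ?r" for v
  proof -
    have "(\<lambda>i. if i < ?r then v i else 0) = v" using that by (intro ext) (simp add: free_carrier_def)
    then show ?thesis using gH[OF order_refl that] by simp
  qed
  ultimately show "\<exists>h\<in>lmod_hom (gfree gr ds) M. \<forall>x\<in>carrier (gfree gr ds). g (h x) = f x"
    by (auto simp: gfree_simps)
qed

context connected_graded_algebra
begin

lemma zero_in_augmentation_ideal: "0 \<in> augmentation_ideal gr"
  by (simp add: augmentation_ideal_def homog_part_0)

lemma add_in_augmentation_ideal:
  "a \<in> augmentation_ideal gr \<Longrightarrow> b \<in> augmentation_ideal gr \<Longrightarrow> a + b \<in> augmentation_ideal gr"
  by (simp add: augmentation_ideal_def homog_part_add)

lemma sum_in_augmentation_ideal: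
  "(\<And>i. i \<in> I \<Longrightarrow> f i \<in> augmentation_ideal gr) \<Longrightarrow> sum f I \<in> augmentation_ideal gr"
  by (simp add: augmentation_ideal_def homog_part_sum)

lemma one_in_gr: "1 \<in> gr 0"
proof -
  have "1 = scale 1 1" by simp
  then show ?thesis using gr_connected by (metis rangeI)
qed

lemma one_not_in_augmentation_ideal: "1 \<notin> augmentation_ideal gr"
  using homog_part_homog[OF one_in_gr, of 0] by (simp add: augmentation_ideal_def)

lemma subspace_gr_int: "subspace (gr_int gr q)"
  using gr_subspace by (simp add: gr_int_def subspace_def)

lemma unit_seq_in_gcomp:
  assumes "j < length ds" shows "unit_seq j \<in> gcomp (gfree gr ds) (ds ! j)"
  using assms one_in_gr zero_in_gr subspace_0[OF subspace_gr_int]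
  by (auto simp: gcomp_gfree seq_box_def unit_seq_def) (simp add: gr_int_def)

text \<open>The vectors with all coordinates in the augmentation ideal form a subgroup that contains
  the generators of \<open>aug_submodule\<close>. Minimality becomes a condition on matrix
  entries.\<close>

lemma aug_submodule_gfree:
  assumes "left_module (gfree gr ds)" "v \<in> aug_submodule gr (gfree gr ds)"
  shows "v i \<in> augmentation_ideal gr"
proof -
  interpret M: left_module "gfree gr ds" by (rule assms(1))
  let ?N = "{v. \<forall>i. v i \<in> augmentation_ideal gr} \<inter> free_carrier (length ds)"
  have inv: "(\<ominus>\<^bsub>gfree gr ds\<^esub> v) = (\<lambda>i. - v i)" if "v \<in> free_carrier (length ds)" for v
    using that by (intro M.minus_equality) (auto simp: gfree_simps free_carrier_def)
  have "subgroup ?N (add_monoid (gfree gr ds))"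
  proof
    show "?N \<subseteq> carrier (add_monoid (gfree gr ds))" by (auto simp: gfree_simps)
    show "\<one>\<^bsub>add_monoid (gfree gr ds)\<^esub> \<in> ?N"
      by (auto simp: gfree_simps free_carrier_def zero_in_augmentation_ideal)
  next
    fix x y assume "x \<in> ?N" "y \<in> ?N"
    then show "x \<otimes>\<^bsub>add_monoid (gfree gr ds)\<^esub> y \<in> ?N"
      by (auto simp: gfree_simps free_carrier_def add_in_augmentation_ideal)
  next
    fix x assume x: "x \<in> ?N"
    then have "(\<ominus>\<^bsub>gfree gr ds\<^esub> x) = (\<lambda>i. - x i)" by (intro inv) auto
    moreover have "(\<lambda>i. - x i) \<in> ?N"
      using x by (auto simp: free_carrier_def augmentation_ideal_def homog_part_uminus)
    ultimately show "inv\<^bsub>add_monoid (gfree gr ds)\<^esub> x \<in> ?N" by (simp add: a_inv_def)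
  qed
  moreover have "{a \<odot>\<^bsub>gfree gr ds\<^esub> x | a x. a \<in> augmentation_ideal gr \<and> x \<in> carrier (gfree gr ds)} \<subseteq> ?N"
    by (auto simp: gfree_simps free_carrier_def mult_in_augmentation_ideal)
  ultimately have "aug_submodule gr (gfree gr ds) \<subseteq> ?N"
    unfolding aug_submodule_def by (intro M.add.generate_subgroup_incl)
  then show ?thesis using assms(2) by auto
qed

end

section \<open>The differentials as matrices\<close>

locale minimal_free_resolution = generated_graded_algebra +
  fixes ds :: "nat \<Rightarrow> int list"
    and d :: "nat \<Rightarrow> (nat \<Rightarrow> 'b) \<Rightarrow> nat \<Rightarrow> 'b" and \<epsilon> :: "(nat \<Rightarrow> 'b) \<Rightarrow> 'a"
  assumes minimal:
    "minimal_graded_resolution gr (k_module scale gr 0) (\<lambda>i. gfree gr (ds i)) d \<epsilon>"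
begin

abbreviation rk :: "nat \<Rightarrow> nat" where "rk i \<equiv> length (ds i)"

abbreviation entry :: "nat \<Rightarrow> nat \<Rightarrow> nat \<Rightarrow> 'b" where "entry i j k \<equiv> d i (unit_seq j) k"

text \<open>The row vector \<open>v\<close> times the matrix of \<open>d i\<close>. In contrast to
  \<open>d i\<close> it is linear on all sequences, so that its rules hold without membership
  conditions.\<close>

definition dmat :: "nat \<Rightarrow> (nat \<Rightarrow> 'b) \<Rightarrow> nat \<Rightarrow> 'b" where
  "dmat i v = (\<lambda>k. \<Sum>j<rk (Suc i). v j * entry i j k)"

lemma graded: "graded_resolution gr (k_module scale gr 0) (\<lambda>i. gfree gr (ds i)) d \<epsilon>"
  using minimal by (simp add: minimal_graded_resolution_def)

lemma left_module_gfree: "left_module (gfree gr (ds i))"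
  using graded by (auto simp: graded_resolution_def resolution_def)

lemma d_hom: "d i \<in> lmod_hom (gfree gr (ds (Suc i))) (gfree gr (ds i))"
  using graded by (auto simp: graded_resolution_def resolution_def)

lemma eps_hom: "\<epsilon> \<in> lmod_hom (gfree gr (ds 0)) (k_module scale gr 0)"
  using graded by (auto simp: graded_resolution_def resolution_def)

lemma d_eq_dmat:
  assumes "v \<in> free_carrier (rk (Suc i))" shows "d i v = dmat i v"
proof
  fix k
  note D = lmod_homD[OF d_hom[of i], unfolded gfree_simps]
  show "d i v k = dmat i v k" unfolding dmat_def
    by (rule free_linear_expansion[of "rk (Suc i)" "\<lambda>v. d i v k"]) (use D assms in auto)
qed

lemma dmat_closed: "dmat i v \<in> free_carrier (rk i)"
proof -
  have "entry i j k = 0" if "j < rk (Suc i)" "k \<ge> rk i" for j k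
    using lmod_homD(1)[OF d_hom[of i], unfolded gfree_simps, OF unit_seq_free_carrier[OF that(1)]] that(2)
    by (simp add: free_carrier_def)
  then show ?thesis by (auto simp: free_carrier_def dmat_def)
qed

lemma dmat_exact:
  "dmat (Suc i) ` free_carrier (rk (Suc (Suc i))) = {x \<in> free_carrier (rk (Suc i)). dmat i x = (\<lambda>_. 0)}"
proof -
  have "d (Suc i) ` carrier (gfree gr (ds (Suc (Suc i)))) =
      {x \<in> carrier (gfree gr (ds (Suc i))). d i x = \<zero>\<^bsub>gfree gr (ds i)\<^esub>}"
    using graded by (simp add: graded_resolution_def resolution_def)
  then show ?thesis unfolding gfree_simps
    by (simp add: d_eq_dmat cong: image_cong conj_cong)
qed

lemma dmat_exact_0:
  "dmat 0 ` free_carrier (rk 1) = {x \<in> free_carrier (rk 0). \<epsilon> x = 0}"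
proof -
  have "d 0 ` carrier (gfree gr (ds 1)) =
      {x \<in> carrier (gfree gr (ds 0)). \<epsilon> x = \<zero>\<^bsub>k_module scale gr 0\<^esub>}"
    using graded unfolding graded_resolution_def resolution_def by (elim conjE)
  then show ?thesis unfolding gfree_simps
    by (simp add: d_eq_dmat k_module_def cong: image_cong)
qed

text \<open>\<open>dmat\<close> reads only the coordinates below the rank, so an arbitrary
  \<open>v\<close> may be truncated to a member of the free module before exactness is
  applied.\<close>

lemma dmat_dmat: "dmat i (dmat (Suc i) v) = (\<lambda>_. 0)"
proof -
  define w where "w = (\<lambda>j. if j < rk (Suc (Suc i)) then v j else 0)"
  have "dmat (Suc i) v = dmat (Suc i) w" by (auto simp: dmat_def w_def fun_eq_iff)
  moreover have "w \<in> free_carrier (rk (Suc (Suc i)))" by (simp add: w_def free_carrier_def)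
  ultimately show ?thesis using dmat_exact[of i] by auto
qed

lemma dmat_add: "dmat i (\<lambda>j. v j + w j) = (\<lambda>k. dmat i v k + dmat i w k)"
  by (simp add: dmat_def distrib_right sum.distrib)

lemma dmat_smult: "dmat i (\<lambda>j. a * v j) = (\<lambda>k. a * dmat i v k)"
  by (simp add: dmat_def sum_distrib_left mult.assoc)

lemma dmat_unit_seq: "j < rk (Suc i) \<Longrightarrow> dmat i (unit_seq j) = d i (unit_seq j)"
  using d_eq_dmat[OF unit_seq_free_carrier] by simp

lemma entry_degree:
  assumes "j < rk (Suc i)" "k < rk i"
  shows "entry i j k \<in> gr_int gr (ds (Suc i) ! j - ds i ! k)"
proof -
  have "d i ` gcomp (gfree gr (ds (Suc i))) (ds (Suc i) ! j) \<subseteq> gcomp (gfree gr (ds i)) (ds (Suc i) ! j)"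
    using graded by (auto simp: graded_resolution_def)
  then have "d i (unit_seq j) \<in> gcomp (gfree gr (ds i)) (ds (Suc i) ! j)"
    using unit_seq_in_gcomp[OF assms(1)] by blast
  then show ?thesis using assms(2) by (simp add: gcomp_gfree seq_box_def)
qed

lemma dmat_augmentation_ideal:
  assumes "v \<in> free_carrier (rk (Suc i))" shows "dmat i v k \<in> augmentation_ideal gr"
proof -
  have "d i ` carrier (gfree gr (ds (Suc i))) \<subseteq> aug_submodule gr (gfree gr (ds i))"
    using minimal by (simp add: minimal_graded_resolution_def)
  then have "d i v \<in> aug_submodule gr (gfree gr (ds i))"
    using assms by (auto simp: gfree_simps)
  then show ?thesis using aug_submodule_gfree[OF left_module_gfree] d_eq_dmat[OF assms] by metis
qed

lemma entry_augmentation_ideal: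
  "j < rk (Suc i) \<Longrightarrow> entry i j k \<in> augmentation_ideal gr"
  using dmat_augmentation_ideal[OF unit_seq_free_carrier] dmat_unit_seq by metis

text \<open>The entry would have nonpositive degree, and minimality puts it into the augmentation
  ideal. This gives the matrices their blocks of zeros.\<close>

lemma entry_eq_0:
  assumes "j < rk (Suc i)" "k < rk i" "ds (Suc i) ! j \<le> ds i ! k" shows "entry i j k = 0"
  using gr_int_augmentation_ideal[OF entry_degree[OF assms(1,2)] _ entry_augmentation_ideal[OF assms(1)]]
    assms(3) by simp

end

section \<open>Consequences of minimality and of the Gorenstein condition\<close>

context minimal_free_resolution
begin

lemma unit_seq_not_dmat:
  assumes "v \<in> free_carrier (rk (Suc i))" shows "dmat i v \<noteq> unit_seq j"
proof
  assume "dmat i v = unit_seq j"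
  then have "dmat i v j = 1" by (simp add: unit_seq_def)
  then show False using dmat_augmentation_ideal[OF assms, of j] one_not_in_augmentation_ideal by simp
qed

text \<open>A generator mapped to 0 would be a boundary by exactness, but boundaries have
  coordinates in the augmentation ideal, which does not contain 1.\<close>

lemma dmat_unit_seq_nonzero:
  assumes "j < rk (Suc i)" shows "dmat i (unit_seq j) \<noteq> (\<lambda>_. 0)"
proof
  assume "dmat i (unit_seq j) = (\<lambda>_. 0)"
  then have "unit_seq j \<in> dmat (Suc i) ` free_carrier (rk (Suc (Suc i)))"
    unfolding dmat_exact using unit_seq_free_carrier[OF assms] by simp
  then show False using unit_seq_not_dmat by (metis imageE)
qed

text \<open>Every generator has a nonzero entry in its image, and nonzero entries have positive
  degree; so the degrees rise by at least 1 with each step of the resolution.\<close>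

lemma degree_ge:
  assumes "\<And>j. j \<in> set (ds 0) \<Longrightarrow> j \<ge> 0" "j \<in> set (ds i)" shows "j \<ge> int i"
  using assms(2)
proof (induction i arbitrary: j)
  case 0 then show ?case using assms(1) by simp
next
  case (Suc i)
  then obtain p where p: "p < rk (Suc i)" "j = ds (Suc i) ! p" by (metis in_set_conv_nth)
  obtain k where k: "entry i p k \<noteq> 0"
    using dmat_unit_seq_nonzero[OF p(1)] dmat_unit_seq[OF p(1)] by (metis ext)
  then have kr: "k < rk i"
    using dmat_closed[of i "unit_seq p"] dmat_unit_seq[OF p(1)]
    by (intro not_le_imp_less notI) (simp add: free_carrier_def)
  have "ds i ! k < j" using entry_eq_0[OF p(1) kr] k p(2) by fastforce
  moreover have "ds i ! k \<ge> int i" using Suc.IH kr by simp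
  ultimately show ?case by simp
qed

text \<open>
  If a coordinate of \<open>P (Suc i)\<close> vanished on the image of \<open>d (Suc i)\<close>, it would be a cocycle; being a
  coboundary it would take values in the augmentation ideal.
\<close>

lemma ex_entry_nonzero:
  assumes Gor: "Gorenstein scale gr D" and i: "Suc i \<noteq> D" and j: "j < rk (Suc i)"
  shows "\<exists>w<rk (Suc (Suc i)). entry (Suc i) w j \<noteq> 0"
proof (rule ccontr)
  assume "\<not> ?thesis"
  then have zero: "entry (Suc i) w j = 0" if "w < rk (Suc (Suc i))" for w using that by blast
  let ?P = "\<lambda>i. gfree gr (ds i)"
  let ?H = "ghom gr (?P (Suc i))" and ?B = "Ext_coboundaries gr ?P d (Suc i)"
  have "carrier (Ext_module gr ?P d (Suc i)) = {\<zero>\<^bsub>Ext_module gr ?P d (Suc i)\<^esub>}"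
    using Gor i graded projective_gfree[OF left_module_gfree] unfolding Gorenstein_def by blast
  then have Ext0: "?B +>\<^bsub>?H\<^esub> f = ?B" if "f \<in> Ext_cocycles gr ?P d (Suc i)" for f
    using that by (auto simp: Ext_module_def Let_def)
  \<comment> \<open>The projection to coordinate \<open>j\<close>, set to 0 outside the carrier as
    \<open>ghom_deg\<close> prescribes.\<close>
  define f :: "(nat \<Rightarrow> 'b) \<Rightarrow> 'b" where "f v = (if v \<in> free_carrier (rk (Suc i)) then v j else 0)" for v
  have fdeg: "f \<in> ghom_deg gr (?P (Suc i)) (- (ds (Suc i) ! j))"
    unfolding ghom_deg_def
  proof (intro CollectI conjI ballI allI impI)
    fix n show "f ` gcomp (?P (Suc i)) n \<subseteq> gr_int gr (n + - (ds (Suc i) ! j))"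
      using j by (auto simp: gcomp_gfree seq_box_def f_def free_carrier_def)
  qed (auto simp: gfree_simps f_def free_carrier_def)
  have "f \<in> carrier ?H"
    unfolding ghom_def using fdeg
    by (auto intro!: exI[of _ "{- (ds (Suc i) ! j)}"] exI[of _ "\<lambda>_. f"])
  moreover have "f (d (Suc i) x) = 0" if "x \<in> free_carrier (rk (Suc (Suc i)))" for x
    using zero by (simp add: d_eq_dmat[OF that] f_def dmat_closed) (simp add: dmat_def)
  ultimately have "f \<in> Ext_cocycles gr ?P d (Suc i)"
    by (simp add: Ext_cocycles_def gfree_simps)
  then have "?B +>\<^bsub>?H\<^esub> f = ?B" by (rule Ext0)
  moreover have "(\<lambda>_. 0) \<in> ?B"
  proof -
    have "(\<lambda>_. 0) \<in> carrier (ghom gr (?P i))"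
      by (auto simp: ghom_def intro!: exI[of _ "{}"])
    then show ?thesis by (auto intro!: exI[of _ "\<lambda>_. 0"])
  qed
  ultimately have "(\<lambda>_. 0) \<oplus>\<^bsub>?H\<^esub> f \<in> ?B"
    unfolding a_r_coset_def r_coset_def by (simp add: set_eq_iff) blast
  then have "f \<in> ?B" by (simp add: ghom_def)
  then obtain g where g: "g \<in> carrier (ghom gr (?P i))"
    and fg: "f = (\<lambda>x. if x \<in> free_carrier (rk (Suc i)) then g (d i x) else 0)"
    by (auto simp: gfree_simps)
  obtain J F where F: "\<And>j. j \<in> J \<Longrightarrow> F j \<in> ghom_deg gr (?P i) j" and gF: "g = (\<lambda>x. \<Sum>j\<in>J. F j x)"
    using g by (auto simp: ghom_def)
  have u: "(unit_seq j :: nat \<Rightarrow> 'b) \<in> free_carrier (rk (Suc i))" by (rule unit_seq_free_carrier[OF j])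
  \<comment> \<open>By linearity the value is a combination of the coordinates of a boundary,
    multiplied on the right; the augmentation ideal absorbs such factors.\<close>
  have "F q (dmat i (unit_seq j)) \<in> augmentation_ideal gr" if "q \<in> J" for q
  proof -
    have "F q (dmat i (unit_seq j)) = (\<Sum>k<rk i. dmat i (unit_seq j) k * F q (unit_seq k))"
      using F[OF that] by (intro free_linear_expansion dmat_closed) (auto simp: ghom_deg_def gfree_simps)
    then show ?thesis
      using dmat_augmentation_ideal[OF u] by (auto intro: sum_in_augmentation_ideal mult_in_augmentation_ideal)
  qed
  then have "g (dmat i (unit_seq j)) \<in> augmentation_ideal gr"
    unfolding gF by (rule sum_in_augmentation_ideal)
  moreover have "f (unit_seq j) = 1" using u by (simp add: f_def) (simp add: unit_seq_def)
  then have "g (dmat i (unit_seq j)) = 1" using fg u d_eq_dmat[OF u] by simp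
  ultimately show False using one_not_in_augmentation_ideal by simp
qed

lemma dmat_row_combination:
  "dmat i (\<lambda>q. if m \<le> q \<and> q < m + k then c (q - m) else 0) j
     = (\<Sum>p<k. c p * entry i (m + p) j)" if "m + k \<le> rk (Suc i)"
proof -
  have "dmat i (\<lambda>q. if m \<le> q \<and> q < m + k then c (q - m) else 0) j
      = (\<Sum>q\<in>{m..<m+k}. c (q - m) * entry i q j)"
    unfolding dmat_def using that by (intro sum.mono_neutral_cong_right) auto
  also have "\<dots> = (\<Sum>p<k. c p * entry i (m + p) j)"
    by (rule sum.reindex_bij_witness[of _ "\<lambda>p. m + p" "\<lambda>q. q - m"]) auto
  finally show ?thesis .
qed

text \<open>
  If the inequality failed, minimality would make \<open>d 2\<close> map the span of the last \<open>k\<close> generators of \<open>P 3\<close>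
  into that of the first \<open>k\<close> generators of \<open>P 2\<close>. It is injective there, as a kernel element, the image of \<open>d 4\<close> and a generator of
  \<open>P 4\<close> would be three independent elements of \<open>P 4\<close>. Together with the first generator of \<open>P 2\<close>, which
  \<open>d 1\<close> does not kill, one gets \<open>k + 1\<close> independent elements of a free module of rank \<open>k\<close>.
\<close>

theorem relation_degrees_lt:
  assumes GK: "GKdim scale < \<infinity>" and Gor: "Gorenstein scale gr D" "D \<noteq> 3"
    and domain: "\<And>x y :: 'b. x * y = 0 \<Longrightarrow> x = 0 \<or> y = 0"
    and ds2: "sorted (ds 2)" and ds3: "ds 3 = map (\<lambda>j. l - j) (ds 2)"
    and rk4: "rk 4 = 2" and rk5: "rk 5 = 1" and rk6: "rk 6 = 0"
    and k: "1 \<le> k" "k < rk 2"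
  shows "ds 2 ! k + ds 2 ! (rk 2 - k) < l"
proof (rule ccontr)
  assume neg: "\<not> ?thesis"
  let ?n = "rk 2"
  \<comment> \<open>The coefficients \<open>c\<close> placed at the last \<open>k\<close> generators
    of \<open>P 3\<close>.\<close>
  let ?c = "\<lambda>c q. if ?n - k \<le> q \<and> q < ?n - k + k then c (q - (?n - k)) else (0::'b)"
  have rk3: "rk 3 = ?n" using ds3 by simp
  have S: "Suc 2 = 3" "Suc 3 = 4" "Suc 4 = 5" "Suc 5 = 6" "Suc 1 = 2" by simp_all
  \<comment> \<open>The last \<open>k\<close> generators of \<open>P 3\<close> have degree at most
    \<open>l - ds 2 ! (?n - k)\<close>, which by the negated claim is at most
    \<open>ds 2 ! k\<close>, hence at most the degree of every generator of \<open>P 2\<close> from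
    index \<open>k\<close> on.\<close>
  have low: "entry 2 (?n - k + p) i = 0" if "p < k" "i \<ge> k" for p i
  proof (cases "i < ?n")
    case True
    have p: "?n - k + p < ?n" using that(1) k by simp
    have "ds 2 ! k \<le> ds 2 ! i" using ds2 that True by (intro sorted_nth_mono) auto
    moreover have "ds 2 ! (?n - k) \<le> ds 2 ! (?n - k + p)" using ds2 p by (intro sorted_nth_mono) auto
    ultimately have "l - ds 2 ! (?n - k + p) \<le> ds 2 ! i" using neg by linarith
    then show ?thesis using entry_eq_0[of "?n - k + p" 2 i] p True ds3 rk3 S by simp
  next
    case False
    have "?n - k + p < rk 3" using that(1) k rk3 by simp
    then have "d 2 (unit_seq (?n - k + p)) = dmat 2 (unit_seq (?n - k + p))"
      using dmat_unit_seq[of _ 2] S by simp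
    then show ?thesis using dmat_closed[of 2] False by (simp add: free_carrier_def)
  qed
  have row: "dmat 2 (?c c) i = (\<Sum>p<k. c p * entry 2 (?n - k + p) i)" for c i
    using dmat_row_combination[of "?n - k" k 2 c i] k rk3 S by simp
  have inj: "c p = 0" if 0: "dmat 2 (?c c) = (\<lambda>_. 0)" and p: "p < k" for c p
  proof (rule ccontr)
    assume cp: "c p \<noteq> 0"
    have "?c c \<in> free_carrier (rk 3)" using k rk3 by (simp add: free_carrier_def)
    then have "?c c \<in> dmat 3 ` free_carrier (rk 4)" using 0 dmat_exact[of 2] S by simp
    then obtain y where y: "y \<in> free_carrier 2" "dmat 3 y = ?c c" using rk4 by auto
    have y0: "dmat 3 y 0 = 0" unfolding y(2) using k by simp
    define z where "z = dmat 4 (unit_seq 0)"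
    have z: "z \<noteq> (\<lambda>_. 0)" unfolding z_def using dmat_unit_seq_nonzero[of 0 4] rk5 S by simp
    have zc: "z \<in> free_carrier 2" using dmat_closed[of 4] rk4 by (simp add: z_def)
    have dz: "dmat 3 z = (\<lambda>_. 0)" unfolding z_def using dmat_dmat[of 3] S by simp
    \<comment> \<open>Coordinate 0 separates the three vectors: since \<open>k < ?n\<close> it lies
      outside the last \<open>k\<close>, so it vanishes on the images of \<open>y\<close> and
      \<open>z\<close>, but not on that of generator \<open>w\<close>. After that, coordinate
      \<open>?n - k + p\<close> of the image isolates \<open>y\<close>, which leaves the nonzero
      \<open>z\<close>.\<close>
    obtain w where w: "w < 2" "entry 3 w 0 \<noteq> 0"
      using ex_entry_nonzero[OF Gor(1), of 2 0] Gor(2) rk3 rk4 k S by (metis not_less_zero neq0_conv)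
    have dw: "dmat 3 (unit_seq w) 0 \<noteq> 0" using w dmat_unit_seq[of w 3] rk4 S by simp
    define v :: "nat \<Rightarrow> nat \<Rightarrow> 'b" where "v = (\<lambda>i. if i = 0 then y else if i = 1 then z else unit_seq w)"
    have "3 \<le> (2::nat)"
    proof (rule independent_rows_le[OF GK, where s = 2 and r = 3 and v = v])
      fix b :: "nat \<Rightarrow> 'b" and i :: nat
      assume b: "\<And>j. j < 2 \<Longrightarrow> (\<Sum>i<3. b i * v i j) = 0" and i: "i < 3"
      have eq: "(\<lambda>j. b 0 * y j + b 1 * z j + b 2 * unit_seq w j) = (\<lambda>_. 0)"
      proof
        fix j
        have "unit_seq w j = (0::'b)" if "j \<ge> 2" using w(1) that by (simp add: unit_seq_def)
        then show "b 0 * y j + b 1 * z j + b 2 * unit_seq w j = 0"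
          using b[of j] y(1) zc by (cases "j < 2") (simp_all add: v_def numeral_eq_Suc free_carrier_def)
      qed
      have app: "b 0 * dmat 3 y q + b 1 * dmat 3 z q + b 2 * dmat 3 (unit_seq w) q = 0" for q
      proof -
        have "dmat 3 (\<lambda>j. b 0 * y j + b 1 * z j + b 2 * unit_seq w j) q = 0"
          unfolding eq by (simp add: dmat_def)
        then show ?thesis by (simp add: dmat_add dmat_smult)
      qed
      have b2: "b 2 = 0" using app[of 0] y0 dz dw domain by auto
      have "b 0 * dmat 3 y (?n - k + p) = 0" using app[of "?n - k + p"] b2 dz by simp
      then have b0: "b 0 = 0" unfolding y(2) using p cp domain by auto
      obtain q where "z q \<noteq> 0" using z by blast
      then have b1: "b 1 = 0" using fun_cong[OF eq, of q] b0 b2 domain by auto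
      show "b i = 0" using i b0 b1 b2 by (auto simp: numeral_eq_Suc less_Suc_eq)
    qed
    then show False by simp
  qed
  define v where "v = (\<lambda>i j. case i of 0 \<Rightarrow> unit_seq 0 j | Suc p \<Rightarrow> entry 2 (?n - k + p) j)"
  have "Suc k \<le> k"
  proof (rule independent_rows_le[OF GK, where s = k and r = "Suc k" and v = v])
    fix c :: "nat \<Rightarrow> 'b" and i :: nat
    assume c: "\<And>j. j < k \<Longrightarrow> (\<Sum>i<Suc k. c i * v i j) = 0" and i: "i < Suc k"
    have eq: "(\<lambda>j. c 0 * unit_seq 0 j + dmat 2 (?c (\<lambda>p. c (Suc p))) j) = (\<lambda>_. 0)"
    proof
      fix j
      show "c 0 * unit_seq 0 j + dmat 2 (?c (\<lambda>p. c (Suc p))) j = 0"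
      proof (cases "j < k")
        case True
        then show ?thesis using c[of j] unfolding row[of "\<lambda>p. c (Suc p)" j] by (simp add: v_def sum.lessThan_Suc_shift del: sum.lessThan_Suc)
      next
        case False
        then have "unit_seq 0 j = (0::'b)" using k by (simp add: unit_seq_def)
        moreover have "(\<Sum>p<k. c (Suc p) * entry 2 (?n - k + p) j) = 0"
          using low False by (intro sum.neutral) auto
        ultimately show ?thesis unfolding row[of "\<lambda>p. c (Suc p)" j] by simp
      qed
    qed
    have "dmat 1 (\<lambda>j. c 0 * unit_seq 0 j + dmat 2 (?c (\<lambda>p. c (Suc p))) j) q = 0" for q
      unfolding eq by (simp add: dmat_def)
    moreover have "dmat 1 (dmat 2 x) = (\<lambda>_. 0)" for x
      using dmat_dmat[of 1 x] by (simp only: S)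
    ultimately have "c 0 * dmat 1 (unit_seq 0) q = 0" for q
      by (simp only: dmat_add dmat_smult add_0_right)
    moreover have "0 < rk (Suc 1)" unfolding S using k by linarith
    then have "dmat 1 (unit_seq 0) \<noteq> (\<lambda>_. 0)" by (rule dmat_unit_seq_nonzero)
    then obtain q where "dmat 1 (unit_seq 0) q \<noteq> 0" by blast
    ultimately have c0: "c 0 = 0" using domain by blast
    then have "dmat 2 (?c (\<lambda>p. c (Suc p))) = (\<lambda>_. 0)" using eq by simp
    then show "c i = 0" using inj[of "\<lambda>p. c (Suc p)"] c0 i by (cases i) auto
  qed
  then show False by simp
qed

end

section \<open>The Euler characteristic of the resolution\<close>

text \<open>For nonnegative degrees, its product with the Hilbert series of the algebra is the
  Hilbert series of the free module generated in the degrees \<open>js\<close>.\<close>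

definition degree_poly :: "int list \<Rightarrow> real poly" where
  "degree_poly js = (\<Sum>j\<leftarrow>js. monom 1 (nat j))"

context connected_graded_algebra
begin

text \<open>Integer indices, because the degrees m - j occurring in the graded pieces of free
  modules may be negative.\<close>

definition int_part :: "'a \<Rightarrow> int \<Rightarrow> 'a" where
  "int_part x q = (if q < 0 then 0 else homog_part gr x (nat q))"

lemma int_part_in_gr_int: "int_part x q \<in> gr_int gr q"
  by (simp add: int_part_def gr_int_def homog_part_props)

lemma int_part_homog: "x \<in> gr_int gr q \<Longrightarrow> int_part x q = x"
  by (auto simp: int_part_def gr_int_def homog_part_homog split: if_splits)

lemma int_part_sum: "int_part (\<Sum>i\<in>I. f i) q = (\<Sum>i\<in>I. int_part (f i) q)"
  by (simp add: int_part_def homog_part_sum)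

lemma int_part_mult:
  assumes "b \<in> gr_int gr p" shows "int_part (a * b) q = int_part a (q - p) * b"
proof (cases "p < 0")
  case True
  then have "b = 0" using assms by (simp add: gr_int_def)
  then show ?thesis by (simp add: int_part_def homog_part_0)
next
  case False
  then have b: "b \<in> gr (nat p)" using assms by (simp add: gr_int_def)
  show ?thesis
  proof (cases "q < 0")
    case True then show ?thesis using False by (simp add: int_part_def)
  next
    case q: False
    have "nat q < nat p \<longleftrightarrow> q - p < 0" using q False by linarith
    moreover have "nat (q - p) = nat q - nat p" using False by (simp add: nat_diff_distrib')
    ultimately show ?thesis using q homog_part_mult_right[OF b, of a "nat q"] by (simp add: int_part_def)
  qed
qed

lemma dim_gr_int: "dim (gr_int gr q) = (if q < 0 then 0 else dim (gr (nat q)))"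
  using dim_eq_0_spanned[of "{0}"] by (simp add: gr_int_def)

lemma dim_gr_0: "dim (gr 0) = 1"
proof -
  have "independent {1::'a}" by (simp add: dependent_single)
  moreover have "gr 0 = span {1}" by (simp add: gr_connected span_singleton)
  ultimately show ?thesis using dim_eq_card_independent by fastforce
qed

end

context generated_graded_algebra
begin

lemma gr_int_finite: "\<exists>B. finite B \<and> gr_int gr q \<subseteq> span B"
proof (cases "q < 0")
  case True
  then show ?thesis by (intro exI[of _ "{}"]) (simp add: gr_int_def)
next
  case False
  then show ?thesis using gr_finite[of "nat q"] by (auto simp: gr_int_def)
qed

text \<open>Each generator of degree j contributes a copy of the Hilbert series shifted by j, whose
  first j terms vanish.\<close>

lemma degree_poly_sums:
  assumes GK: "GKdim scale < \<infinity>" and t: "0 < t" "t < (1::real)" and nonneg: "\<And>j. j \<in> set js \<Longrightarrow> j \<ge> 0"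
  shows "(\<lambda>m. real (\<Sum>j\<leftarrow>js. dim (gr_int gr (int m - j))) * t ^ m)
           sums (poly (degree_poly js) t * (\<Sum>n. real (dim (gr n)) * t ^ n))"
  using nonneg
proof (induction js)
  case Nil then show ?case by (simp add: degree_poly_def)
next
  case (Cons j js)
  let ?h = "\<lambda>n. real (dim (gr n)) * t ^ n" and ?s = "\<lambda>m. real (dim (gr_int gr (int m - j))) * t ^ m"
  have "?h sums suminf ?h" using hilbert_series_summable[OF GK t] by (rule summable_sums)
  then have "(\<lambda>n. t ^ nat j * ?h n) sums (t ^ nat j * suminf ?h)" by (rule sums_mult)
  also have "(\<lambda>n. t ^ nat j * ?h n) = (\<lambda>n. ?s (n + nat j))"
    using Cons.prems[of j] by (simp add: dim_gr_int power_add fun_eq_iff)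
  finally have "?s sums (t ^ nat j * suminf ?h + (\<Sum>i<nat j. ?s i))"
    by (rule sums_iff_shift[THEN iffD1])
  moreover have "(\<Sum>i<nat j. ?s i) = 0" by (intro sum.neutral) (auto simp: dim_gr_int)
  ultimately have "?s sums (t ^ nat j * suminf ?h)" by simp
  from sums_add[OF this Cons.IH] Cons.prems show ?case
    by (simp add: degree_poly_def poly_monom distrib_right)
qed

end

section \<open>Exactness in each degree\<close>

context minimal_free_resolution
begin

text \<open>The homogeneous component of degree \<open>m\<close> of \<open>P i\<close>.\<close>

definition box :: "nat \<Rightarrow> int \<Rightarrow> (nat \<Rightarrow> 'b) set" where
  "box i m = seq_box (rk i) (\<lambda>k. gr_int gr (m - ds i ! k))"

definition gpart :: "nat \<Rightarrow> int \<Rightarrow> (nat \<Rightarrow> 'b) \<Rightarrow> nat \<Rightarrow> 'b" where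
  "gpart i m v = (\<lambda>k. if k < rk i then int_part (v k) (m - ds i ! k) else 0)"

lemma box_subset: "box i m \<subseteq> free_carrier (rk i)"
  by (auto simp: box_def seq_box_def free_carrier_def)

lemma gpart_in_box: "gpart i m v \<in> box i m"
  by (simp add: gpart_def box_def seq_box_def int_part_in_gr_int)

lemma gpart_box: "v \<in> box i m \<Longrightarrow> gpart i m v = v"
  by (auto simp: gpart_def box_def seq_box_def int_part_homog)

text \<open>\<open>gpart\<close> projects onto the component of one degree, and the degree of an
  entry is the difference of the degrees of the two generators, so both sides pick the same
  component of each coefficient.\<close>

lemma dmat_gpart: "dmat i (gpart (Suc i) m v) = gpart i m (dmat i v)"
proof
  fix k
  show "dmat i (gpart (Suc i) m v) k = gpart i m (dmat i v) k"
  proof (cases "k < rk i")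
    case True
    have "int_part (v j * entry i j k) (m - ds i ! k) = int_part (v j) (m - ds (Suc i) ! j) * entry i j k"
      if "j < rk (Suc i)" for j
      using int_part_mult[OF entry_degree[OF that True], of "v j" "m - ds i ! k"] by (simp add: algebra_simps)
    then show ?thesis using True by (simp add: dmat_def gpart_def int_part_sum)
  next
    case False
    then show ?thesis using dmat_closed[of i "gpart (Suc i) m v"] by (simp add: free_carrier_def gpart_def)
  qed
qed

lemma dmat_box_subset: "dmat i ` box (Suc i) m \<subseteq> box i m"
proof
  fix x assume "x \<in> dmat i ` box (Suc i) m"
  then obtain v where "v \<in> box (Suc i) m" "x = dmat i v" by blast
  then have "x = gpart i m (dmat i v)" using dmat_gpart[of i m v] gpart_box[of v "Suc i" m] by simp
  then show "x \<in> box i m" using gpart_in_box by simp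
qed

text \<open>Projecting any preimage to degree \<open>m\<close> gives a preimage of degree
  \<open>m\<close>, because the differentials commute with the projections.\<close>

lemma box_exact:
  "{x \<in> box (Suc i) m. dmat i x = (\<lambda>_. 0)} = dmat (Suc i) ` box (Suc (Suc i)) m"
proof (intro equalityI subsetI)
  fix x assume x: "x \<in> {x \<in> box (Suc i) m. dmat i x = (\<lambda>_. 0)}"
  then obtain y where "x = dmat (Suc i) y" using dmat_exact[of i] box_subset[of "Suc i" m] by blast
  moreover have "x = gpart (Suc i) m x" using gpart_box x by simp
  ultimately have "x = dmat (Suc i) (gpart (Suc (Suc i)) m y)" by (simp add: dmat_gpart)
  then show "x \<in> dmat (Suc i) ` box (Suc (Suc i)) m" using gpart_in_box by blast
next
  fix x assume "x \<in> dmat (Suc i) ` box (Suc (Suc i)) m"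
  then show "x \<in> {x \<in> box (Suc i) m. dmat i x = (\<lambda>_. 0)}"
    using dmat_box_subset[of "Suc i" m] dmat_dmat[of i] by auto
qed

lemma box_exact_0: "{x \<in> box 0 m. \<epsilon> x = 0} = dmat 0 ` box (Suc 0) m"
proof (intro equalityI subsetI)
  fix x assume x: "x \<in> {x \<in> box 0 m. \<epsilon> x = 0}"
  then obtain y where "x = dmat 0 y" using dmat_exact_0 box_subset[of 0 m] by blast
  moreover have "x = gpart 0 m x" using gpart_box x by simp
  ultimately have "x = dmat 0 (gpart (Suc 0) m y)" by (simp add: dmat_gpart)
  then show "x \<in> dmat 0 ` box (Suc 0) m" using gpart_in_box by blast
next
  fix x assume x: "x \<in> dmat 0 ` box (Suc 0) m"
  then have "x \<in> dmat 0 ` free_carrier (rk 1)" using box_subset[of "Suc 0" m] by auto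
  then have "\<epsilon> x = 0" using dmat_exact_0 by blast
  then show "x \<in> {x \<in> box 0 m. \<epsilon> x = 0}" using x dmat_box_subset[of 0 m] by auto
qed

definition gdim :: "nat \<Rightarrow> int \<Rightarrow> nat" where
  "gdim i m = (\<Sum>j\<leftarrow>ds i. dim (gr_int gr (m - j)))"

definition image_dim :: "nat \<Rightarrow> int \<Rightarrow> nat" where
  "image_dim i m = vector_space.dim (seq_scale scale) (dmat i ` box (Suc i) m)"

lemma dim_box: "vector_space.dim (seq_scale scale) (box i m) = gdim i m"
proof -
  have "vector_space.dim (seq_scale scale) (box i m) = (\<Sum>k<rk i. dim (gr_int gr (m - ds i ! k)))"
    unfolding box_def by (rule dim_seq_box[THEN conjunct2]) (simp_all add: subspace_gr_int gr_int_finite)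
  then show ?thesis by (simp add: gdim_def sum_list_sum_nth atLeast0LessThan)
qed

text \<open>Rank-nullity in degree \<open>m\<close>, with the kernel replaced by the next
  image.\<close>

lemma gdim_Suc: "gdim (Suc i) m = image_dim i m + image_dim (Suc i) m"
proof -
  interpret seq: vector_space "seq_scale scale" by (rule vector_space_seq)
  interpret pp: vector_space_pair "seq_scale scale" "seq_scale scale" by unfold_locales
  have lin: "Vector_Spaces.linear (seq_scale scale) (seq_scale scale) (dmat i)"
    by unfold_locales
      (auto simp: dmat_def seq_scale_def fun_eq_iff distrib_right sum.distrib scale_mult_left scale_sum_right)
  have fin: "\<exists>B. finite B \<and> box (Suc i) m \<subseteq> seq.span B"
    unfolding box_def by (rule dim_seq_box[THEN conjunct1]) (simp_all add: subspace_gr_int gr_int_finite)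
  have sub: "seq.subspace (box (Suc i) m)"
    unfolding box_def by (rule subspace_seq_box) (rule subspace_gr_int)
  obtain B where "finite B" "box (Suc i) m \<subseteq> seq.span B" using fin by blast
  from pp.rank_nullity[OF lin sub this(2,1)] show ?thesis
    using box_exact[of i m] by (simp add: dim_box image_dim_def zero_fun_def)
qed

text \<open>\<open>\<epsilon>\<close> is the augmentation times a constant, nonzero by surjectivity:
  injective on the scalars in degree 0, and zero in all other degrees because \<open>k\<close> sits
  in degree 0.\<close>

lemma image_dim_0:
  assumes ds0: "ds 0 = [0]"
  shows "gdim 0 m = image_dim 0 m + (if m = 0 then 1 else 0)"
proof -
  interpret seq: vector_space "seq_scale scale" by (rule vector_space_seq)
  note E = lmod_homD[OF eps_hom, unfolded gfree_simps]
  have u: "(unit_seq 0 :: nat \<Rightarrow> 'b) \<in> free_carrier (rk 0)" using ds0 by (intro unit_seq_free_carrier) simp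
  have eps: "\<epsilon> v = augmentation scale gr (v 0) * \<epsilon> (unit_seq 0)" if "v \<in> free_carrier (rk 0)" for v
  proof -
    have "v = (\<lambda>i. v 0 * unit_seq 0 i)" using that ds0 by (auto simp: free_carrier_def unit_seq_def)
    then have "\<epsilon> v = \<epsilon> (\<lambda>i. v 0 * unit_seq 0 i)" by simp
    also have "\<dots> = augmentation scale gr (v 0) * \<epsilon> (unit_seq 0)"
      using E(3)[OF u, of "v 0"] by (simp add: k_module_def)
    finally show ?thesis .
  qed
  have "\<epsilon> ` carrier (gfree gr (ds 0)) = carrier (k_module scale gr 0)"
    using graded by (simp add: graded_resolution_def resolution_def)
  then have "1 \<in> \<epsilon> ` free_carrier (rk 0)" by (simp add: gfree_simps k_module_def)
  then have e0: "\<epsilon> (unit_seq 0) \<noteq> 0" using eps by fastforce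
  have kdim: "image_dim 0 m = seq.dim {x \<in> box 0 m. \<epsilon> x = 0}"
    by (simp add: image_dim_def box_exact_0)
  show ?thesis
  proof (cases "m = 0")
    case True
    have "{x \<in> box 0 m. \<epsilon> x = 0} \<subseteq> {0}"
    proof
      fix x assume x: "x \<in> {x \<in> box 0 m. \<epsilon> x = 0}"
      then have "x 0 \<in> gr 0" using ds0 True by (simp add: box_def seq_box_def gr_int_def)
      then obtain c where c: "x 0 = scale c 1" using gr_connected by auto
      have "\<epsilon> x = c * \<epsilon> (unit_seq 0)"
        using eps[of x] x box_subset[of 0 m] by (auto simp: c augmentation_scale_one)
      then have "c = 0" using x e0 by simp
      then have "x i = 0" for i using c x ds0 by (cases i) (auto simp: box_def seq_box_def)
      then show "x \<in> {0}" by auto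
    qed
    then have "image_dim 0 m = 0" unfolding kdim by (rule seq.dim_eq_0_spanned)
    then show ?thesis using True ds0 by (simp add: gdim_def dim_gr_int dim_gr_0)
  next
    case False
    have "\<epsilon> ` gcomp (gfree gr (ds 0)) m \<subseteq> gcomp (k_module scale gr 0) m"
      using graded by (simp add: graded_resolution_def)
    then have "\<epsilon> ` box 0 m \<subseteq> {0}" using False by (simp add: gcomp_gfree box_def k_module_def)
    then have "{x \<in> box 0 m. \<epsilon> x = 0} = box 0 m" by auto
    then show ?thesis using False by (simp add: kdim dim_box)
  qed
qed

lemma image_dim_eq_0:
  assumes "rk (Suc i) = 0" shows "image_dim i m = 0"
proof -
  interpret seq: vector_space "seq_scale scale" by (rule vector_space_seq)
  have "dmat i ` box (Suc i) m \<subseteq> {0}" using assms by (auto simp: dmat_def)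
  then show ?thesis unfolding image_dim_def by (rule seq.dim_eq_0_spanned)
qed

text \<open>The alternating sum of the dimensions in degree m telescopes to 1 for m = 0 and to 0
  otherwise, the term beyond \<open>P 5\<close> being 0. Multiplication by t^m and summation over m
  give the claim.\<close>

theorem hilbert_series_inverse:
  assumes GK: "GKdim scale < \<infinity>" and t: "0 < t" "t < (1::real)"
    and ds0: "ds 0 = [0]" and rk6: "rk 6 = 0"
  shows "poly (degree_poly (ds 0) - degree_poly (ds 1) + degree_poly (ds 2) - degree_poly (ds 3)
      + degree_poly (ds 4) - degree_poly (ds 5)) t * (\<Sum>n. real (dim (gr n)) * t ^ n) = 1"
proof -
  let ?h = "\<Sum>n. real (dim (gr n)) * t ^ n"
  define g where "g i m = real (gdim i (int m)) * t ^ m" for i m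
  have nonneg: "j \<ge> 0" if "j \<in> set (ds i)" for i j
    using degree_ge[OF _ that] ds0 by fastforce
  have gs: "g i sums (poly (degree_poly (ds i)) t * ?h)" for i
    unfolding g_def gdim_def by (rule degree_poly_sums[OF GK t nonneg])
  have euler: "real (gdim 0 m) - real (gdim 1 m) + real (gdim 2 m) - real (gdim 3 m) + real (gdim 4 m)
      - real (gdim 5 m) = (if m = 0 then 1 else 0)" for m
    using image_dim_0[OF ds0, of m] gdim_Suc[of 0 m] gdim_Suc[of 1 m] gdim_Suc[of 2 m] gdim_Suc[of 3 m]
      gdim_Suc[of 4 m] image_dim_eq_0[of 5 m] rk6 by (simp add: eval_nat_numeral)
  have "(\<lambda>m. g 0 m - g 1 m + g 2 m - g 3 m + g 4 m - g 5 m) sums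
      (poly (degree_poly (ds 0)) t * ?h - poly (degree_poly (ds 1)) t * ?h + poly (degree_poly (ds 2)) t * ?h
       - poly (degree_poly (ds 3)) t * ?h + poly (degree_poly (ds 4)) t * ?h - poly (degree_poly (ds 5)) t * ?h)"
    by (intro sums_add sums_diff gs)
  moreover have "g 0 m - g 1 m + g 2 m - g 3 m + g 4 m - g 5 m = (if m = 0 then 1 else 0)" for m
  proof -
    have "g 0 m - g 1 m + g 2 m - g 3 m + g 4 m - g 5 m
        = (if int m = 0 then 1 else 0) * t ^ m"
      unfolding euler[of "int m", symmetric] g_def by (simp only: algebra_simps)
    then show ?thesis by simp
  qed
  moreover have "(\<lambda>m. if m = 0 then 1 else 0 :: real) sums 1"
    using sums_single[of 0 "\<lambda>_. 1::real"] by simp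
  ultimately have "poly (degree_poly (ds 0)) t * ?h - poly (degree_poly (ds 1)) t * ?h
      + poly (degree_poly (ds 2)) t * ?h - poly (degree_poly (ds 3)) t * ?h
      + poly (degree_poly (ds 4)) t * ?h - poly (degree_poly (ds 5)) t * ?h = 1"
    by (simp add: sums_unique2)
  then show ?thesis by (simp add: algebra_simps)
qed

end

section \<open>The degrees of the relations\<close>

lemma dvd_pderiv_power:
  fixes p :: "'a::idom poly"
  assumes "[:-c, 1:] ^ Suc n dvd p"
  shows "poly p c = 0" "[:-c, 1:] ^ n dvd pderiv p"
proof -
  obtain q where q: "p = [:-c, 1:] ^ Suc n * q" using assms by (rule dvdE)
  then show "poly p c = 0" by simp
  have "pderiv p = [:-c, 1:] ^ n * ([:-c, 1:] * pderiv q + smult (of_nat (Suc n)) q)"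
    unfolding q pderiv_mult pderiv_power_Suc by (simp add: pderiv_pCons algebra_simps)
  then show "[:-c, 1:] ^ n dvd pderiv p" by simp
qed

lemma degree_poly_pderiv:
  assumes "\<And>j. j \<in> set js \<Longrightarrow> j \<ge> 0"
  shows "poly (pderiv (degree_poly js)) 1 = of_int (\<Sum>j\<leftarrow>js. j)"
    and "poly (pderiv (pderiv (degree_poly js))) 1 = of_int (\<Sum>j\<leftarrow>js. j * (j - 1))"
    and "poly (pderiv (pderiv (pderiv (degree_poly js)))) 1 = of_int (\<Sum>j\<leftarrow>js. j * (j - 1) * (j - 2))"
proof -
  \<comment> \<open>Whenever a subtraction of naturals truncates, an earlier factor is already
    0.\<close>
  have *: "real (nat j) * real (nat j - Suc 0) = of_int (j * (j - 1))"
    "real (nat j) * real (nat j - Suc 0) * real (nat j - Suc 0 - Suc 0) = of_int (j * (j - 1) * (j - 2))"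
    if "j \<ge> 0" for j
  proof -
    have "\<exists>m. j = int m" by (rule zero_le_imp_eq_int[OF that])
    then obtain m where m: "j = int m" ..
    show "real (nat j) * real (nat j - Suc 0) = of_int (j * (j - 1))"
      unfolding m by (cases m) (auto simp: algebra_simps)
    show "real (nat j) * real (nat j - Suc 0) * real (nat j - Suc 0 - Suc 0) = of_int (j * (j - 1) * (j - 2))"
    proof (cases "m < 2")
      case True
      then have "m = 0 \<or> m = 1" by auto
      then show ?thesis unfolding m by auto
    next
      case False
      then obtain p where "m = Suc (Suc p)" by (metis add_2_eq_Suc le_add_diff_inverse not_less)
      then show ?thesis unfolding m by (simp add: algebra_simps)
    qed
  qed
  show "poly (pderiv (degree_poly js)) 1 = of_int (\<Sum>j\<leftarrow>js. j)"
    using assms by (induction js) (auto simp: degree_poly_def pderiv_add pderiv_monom poly_monom)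
  show "poly (pderiv (pderiv (degree_poly js))) 1 = of_int (\<Sum>j\<leftarrow>js. j * (j - 1))"
    using assms *(1) by (induction js) (auto simp: degree_poly_def pderiv_add pderiv_monom poly_monom)
  show "poly (pderiv (pderiv (pderiv (degree_poly js)))) 1 = of_int (\<Sum>j\<leftarrow>js. j * (j - 1) * (j - 2))"
    using assms
  proof (induction js)
    case (Cons j js)
    have "poly (pderiv (pderiv (pderiv (monom 1 (nat j))))) 1 = real_of_int (j * (j - 1) * (j - 2))"
      unfolding *(2)[OF Cons.prems[of j, simplified], symmetric] by (simp add: pderiv_monom poly_monom mult_ac)
    then show ?case using Cons by (simp add: degree_poly_def pderiv_add)
  qed (simp add: degree_poly_def)
qed

text \<open>
  The conditions are the vanishing of the first three derivatives at \<open>1\<close>, in terms of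
  \<open>l - 2 a\<^sub>i\<close>, in which odd powers eliminate the second one.
\<close>

lemma degree_power_sums:
  fixes a :: "int list" and l :: int
  defines "F \<equiv> degree_poly [0] - degree_poly [1, 1] + degree_poly a - degree_poly (map (\<lambda>j. l - j) a)
      + degree_poly [l - 1, l - 1] - degree_poly [l]"
  assumes dvd: "[:-1, 1:] ^ 4 dvd F" and a: "\<And>j. j \<in> set a \<Longrightarrow> 0 \<le> j \<and> j \<le> l" and l: "l \<ge> 1"
  shows "(\<Sum>i<length a. l - 2 * a ! i) = l - 4"
    and "(\<Sum>i<length a. (l - 2 * a ! i) ^ 3) = l ^ 3 - 12 * l ^ 2 + 24 * l - 16"
proof -
  let ?n = "length a"
  have dvd': "[:-1, 1:] ^ Suc (Suc (Suc (Suc 0))) dvd F" using dvd by (simp add: numeral_eq_Suc)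
  note D1 = dvd_pderiv_power[OF dvd']
  note D2 = dvd_pderiv_power[OF D1(2)]
  note D3 = dvd_pderiv_power[OF D2(2)]
  note D4 = dvd_pderiv_power[OF D3(2)]
  have P: "poly (pderiv (degree_poly js)) 1 = of_int (\<Sum>j\<leftarrow>js. j)"
    "poly (pderiv (pderiv (degree_poly js))) 1 = of_int (\<Sum>j\<leftarrow>js. j * (j - 1))"
    "poly (pderiv (pderiv (pderiv (degree_poly js)))) 1 = of_int (\<Sum>j\<leftarrow>js. j * (j - 1) * (j - 2))"
    if "js \<in> {[0], [1, 1], a, map (\<lambda>j. l - j) a, [l - 1, l - 1], [l]}" for js
    by (rule degree_poly_pderiv; use that a l in auto)+
  \<comment> \<open>The alternating sum of \<open>f\<close> over the degrees of all generators; on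
    falling factorials it gives the derivatives of \<open>F\<close> at 1.\<close>
  define L where "L f = f 0 - 2 * f 1 + (\<Sum>i<?n. f (a ! i) - f (l - a ! i)) + 2 * f (l - 1) - f l"
    for f :: "int \<Rightarrow> int"
  have Leq: "(\<Sum>j\<leftarrow>[0]. f j) - (\<Sum>j\<leftarrow>[1, 1]. f j) + (\<Sum>j\<leftarrow>a. f j) - (\<Sum>j\<leftarrow>map (\<lambda>j. l - j) a. f j)
      + (\<Sum>j\<leftarrow>[l - 1, l - 1]. f j) - (\<Sum>j\<leftarrow>[l]. f j) = L f" for f :: "int \<Rightarrow> int"
    by (simp add: L_def sum_subtractf sum_list_sum_nth atLeast0LessThan)
  have "of_int (L (\<lambda>j. j)) = poly (pderiv F) 1"
    unfolding Leq[symmetric] F_def by (simp only: pderiv_add pderiv_diff poly_add poly_diff P insert_iff simp_thms of_int_add of_int_diff)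
  then have L1: "L (\<lambda>j. j) = 0" using D2(1) by simp
  have "of_int (L (\<lambda>j. j * (j - 1))) = poly (pderiv (pderiv F)) 1"
    unfolding Leq[symmetric] F_def by (simp only: pderiv_add pderiv_diff poly_add poly_diff P insert_iff simp_thms of_int_add of_int_diff)
  then have L2: "L (\<lambda>j. j * (j - 1)) = 0" using D3(1) by simp
  have "of_int (L (\<lambda>j. j * (j - 1) * (j - 2))) = poly (pderiv (pderiv (pderiv F))) 1"
    unfolding Leq[symmetric] F_def by (simp only: pderiv_add pderiv_diff poly_add poly_diff P insert_iff simp_thms of_int_add of_int_diff)
  then have L3: "L (\<lambda>j. j * (j - 1) * (j - 2)) = 0" using D4(1) by simp
  define T where "T f = (\<Sum>i<?n. f (a ! i) - f (l - a ! i))" for f :: "int \<Rightarrow> int"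
  have LT: "L f = f 0 - 2 * f 1 + T f + 2 * f (l - 1) - f l" for f by (simp add: L_def T_def)
  note L = L1[unfolded LT] L2[unfolded LT] L3[unfolded LT]
  have "(\<Sum>i<?n. l - 2 * a ! i) = - T (\<lambda>j. j)"
    unfolding T_def sum_negf[symmetric] by (rule sum.cong) auto
  then show "(\<Sum>i<?n. l - 2 * a ! i) = l - 4" using L(1) by simp
  \<comment> \<open>The cube changes sign under x -> l - x, so it is a combination of the
    antisymmetrised falling factorials collected in \<open>T\<close>.\<close>
  have cube: "(l - 2 * x) ^ 3 = - 4 * (x * (x - 1) * (x - 2) - (l - x) * ((l - x) - 1) * ((l - x) - 2))
      - 12 * (x * (x - 1) - (l - x) * ((l - x) - 1)) + (3 * l ^ 2 - 4) * (x - (l - x))" for x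
    by (simp add: algebra_simps power2_eq_square power3_eq_cube)
  have linear: "(\<Sum>i<?n. A * p i - B * q i + C * r i) = A * sum p {..<?n} - B * sum q {..<?n} + C * sum r {..<?n}"
    for A B C :: int and p q r
    by (simp add: sum.distrib sum_subtractf sum_distrib_left)
  have "(\<Sum>i<?n. (l - 2 * a ! i) ^ 3)
      = (\<Sum>i<?n. - 4 * (a ! i * (a ! i - 1) * (a ! i - 2) - (l - a ! i) * ((l - a ! i) - 1) * ((l - a ! i) - 2))
          - 12 * (a ! i * (a ! i - 1) - (l - a ! i) * ((l - a ! i) - 1))
          + (3 * l ^ 2 - 4) * (a ! i - (l - a ! i)))"
    by (rule sum.cong[OF refl]) (rule cube)
  also have "\<dots> = - 4 * T (\<lambda>j. j * (j - 1) * (j - 2)) - 12 * T (\<lambda>j. j * (j - 1)) + (3 * l ^ 2 - 4) * T (\<lambda>j. j)"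
    unfolding T_def by (rule linear)
  also have "T (\<lambda>j. j) = 4 - l" using L(1) by simp
  also have "T (\<lambda>j. j * (j - 1)) = l * (l - 1) - 2 * ((l - 1) * (l - 2))" using L(2) by simp
  also have "T (\<lambda>j. j * (j - 1) * (j - 2)) = l * (l - 1) * (l - 2) - 2 * ((l - 1) * (l - 2) * (l - 3))"
    using L(3) by simp
  also have "- 4 * (l * (l - 1) * (l - 2) - 2 * ((l - 1) * (l - 2) * (l - 3)))
      - 12 * (l * (l - 1) - 2 * ((l - 1) * (l - 2))) + (3 * l ^ 2 - 4) * (4 - l)
      = l ^ 3 - 12 * l ^ 2 + 24 * l - 16"
    by (simp add: algebra_simps power2_eq_square power3_eq_cube)
  finally show "(\<Sum>i<?n. (l - 2 * a ! i) ^ 3) = l ^ 3 - 12 * l ^ 2 + 24 * l - 16" .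
qed

text \<open>
  Write \<open>\<beta>\<^sub>i = l - 2 a\<^sub>i\<close> and \<open>\<sigma> = a\<^sub>0 - 2\<close>. The pairs \<open>\<beta>\<^sub>k + \<beta>\<^sub>n\<^sub>-\<^sub>k\<close> are at least \<open>2\<close> and add up to
  \<open>4 \<sigma>\<close>, so \<open>n \<le> 2 \<sigma> + 1\<close>; bounding each \<open>\<beta>\<^sub>k\<^sup>3 + \<beta>\<^sub>n\<^sub>-\<^sub>k\<^sup>3\<close> by \<open>3 \<beta>\<^sub>0\<^sup>2 (\<beta>\<^sub>k + \<beta>\<^sub>n\<^sub>-\<^sub>k)\<close> turns the cubic
  identity into an inequality that leaves only \<open>\<sigma> \<le> 2\<close>.
\<close>

lemma cube_sum_le:
  fixes u v B :: int
  assumes "u \<le> B" "v \<le> B" "0 \<le> u + v"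
  shows "u ^ 3 + v ^ 3 \<le> 3 * B ^ 2 * (u + v)"
proof -
  \<comment> \<open>Twice u^2 - u v + v^2 is u^2 + v^2 + (u - v)^2, at most B^2 + B^2 + 4 B^2; this
    is the origin of the factor 3.\<close>
  have "u ^ 2 \<le> B ^ 2" "v ^ 2 \<le> B ^ 2" "(u - v) ^ 2 \<le> (2 * B) ^ 2"
    by (rule abs_le_square_iff[THEN iffD1]; use assms in linarith)+
  then have "u ^ 2 - u * v + v ^ 2 \<le> 3 * B ^ 2"
    by (simp add: power2_eq_square algebra_simps)
  then have "(u ^ 2 - u * v + v ^ 2) * (u + v) \<le> 3 * B ^ 2 * (u + v)"
    using assms(3) by (rule mult_right_mono)
  then show ?thesis by (simp add: power2_eq_square power3_eq_cube algebra_simps)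
qed

lemma sum_reverse: "(\<Sum>k=1..<n. f (n - k)) = (\<Sum>k=1..<n. f k)" for f :: "nat \<Rightarrow> int"
  by (rule sum.reindex_bij_witness[of _ "\<lambda>k. n - k" "\<lambda>k. n - k"]) auto

lemma degree_bounds:
  fixes a :: "int list"
  assumes sorted: "sorted a" and ne: "a \<noteq> []"
    and lin: "(\<Sum>i<length a. l - 2 * a ! i) = l - 4"
    and cub: "(\<Sum>i<length a. (l - 2 * a ! i) ^ 3) = l ^ 3 - 12 * l ^ 2 + 24 * l - 16"
    and pairs: "\<And>k. 1 \<le> k \<Longrightarrow> k < length a \<Longrightarrow> a ! k + a ! (length a - k) < l"
    and l: "l \<ge> 5"
  shows "length a = 2 \<and> a ! 0 = 3 \<or> length a = 3 \<and> a ! 0 = 3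
    \<or> length a \<in> {2..5} \<and> a ! 0 = 4 \<and> l - 2 * a ! 0 \<le> 3"
proof -
  let ?n = "length a"
  define \<beta> where "\<beta> k = l - 2 * a ! k" for k
  define \<sigma> where "\<sigma> = a ! 0 - 2"
  have split: "(\<Sum>i<?n. f i) = f 0 + (\<Sum>k=1..<?n. f k)" for f :: "nat \<Rightarrow> int"
    using ne by (simp add: lessThan_atLeast0 sum.atLeast_Suc_lessThan)
  have l_eq: "l = \<beta> 0 + 2 * \<sigma> + 4" by (simp add: \<beta>_def \<sigma>_def)
  have s1: "(\<Sum>k=1..<?n. \<beta> k) = 2 * \<sigma>"
    using lin split[of \<beta>] by (simp add: \<beta>_def \<sigma>_def)
  have s1': "(\<Sum>k=1..<?n. \<beta> k + \<beta> (?n - k)) = 4 * \<sigma>"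
    using s1 sum_reverse[of \<beta> ?n] by (simp add: sum.distrib)
  have pair: "\<beta> k + \<beta> (?n - k) \<ge> 2" if "k \<in> {1..<?n}" for k
    using pairs[of k] that by (simp add: \<beta>_def)
  have "(\<Sum>k=1..<?n. 2) \<le> (\<Sum>k=1..<?n. \<beta> k + \<beta> (?n - k))" by (rule sum_mono) (rule pair)
  then have n_le: "int ?n - 1 \<le> 2 * \<sigma>" using s1' ne by (simp add: of_nat_diff Suc_leI)
  have mono: "\<beta> k \<le> \<beta> 0" if "k < ?n" for k
    using sorted_nth_mono[OF sorted, of 0 k] that by (simp add: \<beta>_def)
  have s3: "(\<Sum>k=1..<?n. \<beta> k ^ 3) = l ^ 3 - 12 * l ^ 2 + 24 * l - 16 - \<beta> 0 ^ 3"
    using cub split[of "\<lambda>k. \<beta> k ^ 3"] by (simp add: \<beta>_def)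
  have "2 * (\<Sum>k=1..<?n. \<beta> k ^ 3) = (\<Sum>k=1..<?n. \<beta> k ^ 3 + \<beta> (?n - k) ^ 3)"
    using sum_reverse[of "\<lambda>k. \<beta> k ^ 3" ?n] by (simp add: sum.distrib)
  also have "\<dots> \<le> (\<Sum>k=1..<?n. 3 * \<beta> 0 ^ 2 * (\<beta> k + \<beta> (?n - k)))"
  proof (rule sum_mono)
    fix k assume k: "k \<in> {1..<?n}"
    then show "\<beta> k ^ 3 + \<beta> (?n - k) ^ 3 \<le> 3 * \<beta> 0 ^ 2 * (\<beta> k + \<beta> (?n - k))"
      using mono[of k] mono[of "?n - k"] pair[OF k] by (intro cube_sum_le) auto
  qed
  also have "\<dots> = 12 * \<beta> 0 ^ 2 * \<sigma>" by (simp only: sum_distrib_left[symmetric] s1')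
  finally have "l ^ 3 - 12 * l ^ 2 + 24 * l - 16 - \<beta> 0 ^ 3 \<le> 6 * \<beta> 0 ^ 2 * \<sigma>" unfolding s3 by simp
  \<comment> \<open>For \<sigma> = 2 this reads 24 \<beta> 0 \<le> 80, the source of the bound 3 in
    the claim; for \<sigma> \<ge> 3 the left side is too large as soon as \<beta> 0 \<ge> 1.\<close>
  then have key: "12 * (\<sigma> * \<sigma>) * \<beta> 0 + 8 * (\<sigma> * \<sigma> * \<sigma>) \<le> 24 * \<beta> 0 + 48 * \<sigma> + 48"
    unfolding l_eq by (simp add: power2_eq_square power3_eq_cube algebra_simps)
  have "\<sigma> \<ge> 0" using n_le ne by (cases a) auto
  \<comment> \<open>With \<sigma> = 0 there is a single relation, and the cubic identity gives
    \<beta> 0 = -2, that is l = 2.\<close>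
  have "\<sigma> \<noteq> 0"
  proof
    assume 0: "\<sigma> = 0"
    then have "?n = 1" using n_le ne by (cases a) auto
    then have "l ^ 3 - 12 * l ^ 2 + 24 * l - 16 - \<beta> 0 ^ 3 = 0" using s3 by simp
    then show False using 0 l unfolding l_eq by (simp add: power2_eq_square power3_eq_cube algebra_simps)
  qed
  then have "?n \<noteq> 1" using s1 by auto
  moreover have "?n \<noteq> 0" using ne by simp
  ultimately have n2: "?n \<ge> 2" by linarith
  have "?n - 1 < ?n" using n2 by simp
  \<comment> \<open>The pair of indices 1 and n - 1 has sum at least 2, so one member is at least 1,
    and \<beta> 0 is the largest.\<close>
  then have b0: "\<beta> 0 \<ge> 1" using mono[of 1] mono[of "?n - 1"] pair[of 1] n2 by simp
  have "\<sigma> \<le> 2"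
  proof (rule ccontr)
    assume "\<not> \<sigma> \<le> 2"
    then have s: "\<sigma> \<ge> 3" by simp
    then have ss: "9 \<le> \<sigma> * \<sigma>" using mult_mono[of 3 \<sigma> 3 \<sigma>] by simp
    have "9 * \<beta> 0 \<le> \<sigma> * \<sigma> * \<beta> 0" using ss b0 by (intro mult_right_mono) auto
    moreover have "9 * \<sigma> \<le> \<sigma> * \<sigma> * \<sigma>" using ss s by (intro mult_right_mono) auto
    ultimately show False using key s b0 by linarith
  qed
  then have "\<sigma> = 1 \<or> \<sigma> = 2" using \<open>\<sigma> \<ge> 0\<close> \<open>\<sigma> \<noteq> 0\<close> by linarith
  then show ?thesis
  proof
    assume "\<sigma> = 1"
    then show ?thesis using n_le n2 by (auto simp: \<sigma>_def)
  next
    assume "\<sigma> = 2"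
    then show ?thesis using n_le n2 key by (auto simp: \<sigma>_def \<beta>_def)
  qed
qed

lemma degree_list_cases:
  fixes a :: "int list"
  assumes sorted: "sorted a" and ne: "a \<noteq> []"
    and lin: "(\<Sum>i<length a. l - 2 * a ! i) = l - 4"
    and cub: "(\<Sum>i<length a. (l - 2 * a ! i) ^ 3) = l ^ 3 - 12 * l ^ 2 + 24 * l - 16"
    and pairs: "\<And>k. 1 \<le> k \<Longrightarrow> k < length a \<Longrightarrow> a ! k + a ! (length a - k) < l"
    and l: "l \<ge> 5"
  shows "a \<in> {[3, 5, 5], [4, 4, 4], [3, 4, 7], [4, 4, 4, 5], [4, 4, 4, 5, 5]}"
proof -
  have "length a = 2 \<and> a ! 0 = 3 \<or> length a = 3 \<and> a ! 0 = 3
      \<or> length a \<in> {2..5} \<and> a ! 0 = 4 \<and> l - 2 * a ! 0 \<le> 3"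
    by (rule degree_bounds[OF sorted ne lin cub pairs l])
  then show ?thesis
  proof (elim disjE conjE)
    assume n: "length a = 2" and a0: "a ! 0 = 3"
    then obtain b where a: "a = [3, b]" by (auto simp: length_Suc_conv numeral_2_eq_2)
    have lb: "l = 2 * b + 2" using lin by (simp add: a)
    have "(l - 2 * 3) ^ 3 + (l - 2 * b) ^ 3 = l ^ 3 - 12 * l ^ 2 + 24 * l - 16" using cub by (simp add: a)
    \<comment> \<open>No integer solves this: the values at b = 3 and b = 4, the only ones in range,
      are -6 and -4.\<close>
    then have eq: "b * (b - 5) = - 2"
      unfolding lb by (simp add: power2_eq_square power3_eq_cube algebra_simps)
    have "b \<ge> 3" using sorted by (simp add: a)
    moreover have "b < 5" using eq \<open>b \<ge> 3\<close> by (smt (verit) mult_nonneg_nonneg)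
    ultimately have "b = 3 \<or> b = 4" by linarith
    then show ?thesis using eq by auto
  next
    assume n: "length a = 3" and a0: "a ! 0 = 3"
    then obtain b c where a: "a = [3, b, c]" by (auto simp: length_Suc_conv numeral_3_eq_3)
    have lb: "l = b + c + 1" using lin by (simp add: a)
    have bc: "3 \<le> b" "b \<le> c" using sorted by (auto simp: a)
    have "(l - 2 * 3) ^ 3 + (l - 2 * b) ^ 3 + (l - 2 * c) ^ 3 = l ^ 3 - 12 * l ^ 2 + 24 * l - 16"
      using cub by (simp add: a)
    \<comment> \<open>The factorisations 1 * 4 and 2 * 2 are the origin of \<open>[3, 4, 7]\<close>
      and \<open>[3, 5, 5]\<close>.\<close>
    then have eq: "(b - 3) * (c - 3) = 4"
      unfolding lb by (simp add: power2_eq_square power3_eq_cube algebra_simps)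
    have "b \<noteq> 3" using eq by auto
    have "b - 3 \<le> 2"
    proof (rule ccontr)
      assume "\<not> b - 3 \<le> 2"
      then have "3 * 3 \<le> (b - 3) * (c - 3)" using bc by (intro mult_mono) auto
      then show False using eq by simp
    qed
    then have "b = 4 \<or> b = 5" using bc \<open>b \<noteq> 3\<close> by linarith
    then show ?thesis using eq by (auto simp: a)
  next
    assume n: "length a \<in> {2..5}" and a0: "a ! 0 = 4" and l3: "l - 2 * a ! 0 \<le> 3"
    have ge: "a ! k \<ge> 4" if "k < length a" for k
      using sorted_nth_mono[OF sorted, of 0 k] that a0 by simp
    \<comment> \<open>The partner of \<open>a ! k\<close> is at least 4 and l \<le> 11.\<close>
    have le: "a ! k \<le> 6" if "1 \<le> k" "k < length a" for k
    proof -
      have "length a - k < length a" using that by simp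
      then show ?thesis using pairs[OF that] ge[of "length a - k"] l3 a0 by linarith
    qed
    have "length a - 1 < length a" using n by (intro diff_less) auto
    then have l8: "l > 8" using pairs[of 1] ge[of 1] ge[of "length a - 1"] n by simp
    have "l = 9 \<or> l = 10 \<or> l = 11" using l8 l3 a0 by linarith
    note lc = this
    have val: "a ! k = 4 \<or> a ! k = 5 \<or> a ! k = 6" if "1 \<le> k" "k < length a" for k
      using ge[of k] le[of k] that by linarith
    have "length a = 2 \<or> length a = 3 \<or> length a = 4 \<or> length a = 5" using n by auto
    then show ?thesis
    proof (elim disjE)
      assume n: "length a = 2"
      then obtain b where a: "a = [4, b]" using a0 by (auto simp: length_Suc_conv numeral_eq_Suc)
      show ?thesis using lin cub lc val[of 1] unfolding a by auto
    next
      assume n: "length a = 3"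
      then obtain b c where a: "a = [4, b, c]" using a0 by (auto simp: length_Suc_conv numeral_eq_Suc)
      have "(b = 4 \<or> b = 5 \<or> b = 6) \<and> (c = 4 \<or> c = 5 \<or> c = 6)" using val[of 1] val[of 2] by (simp add: a)
      then show ?thesis using lin cub lc sorted unfolding a by auto
    next
      assume n: "length a = 4"
      then obtain b c e where a: "a = [4, b, c, e]" using a0 by (auto simp: length_Suc_conv numeral_eq_Suc)
      have vals: "b = 4 \<or> b = 5 \<or> b = 6" "c = 4 \<or> c = 5 \<or> c = 6"
        using val[of 1] val[of 2] by (simp_all add: a numeral_eq_Suc)
      have e: "2 * e = 3 * l - 2 * b - 2 * c - 4" using lin by (simp add: a numeral_eq_Suc)
      have ord: "b \<le> c" "c \<le> e" using sorted by (simp_all add: a)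
      have c: "2 * c < l" using pairs[of 2] by (simp add: a numeral_eq_Suc)
      \<comment> \<open>The linear identity makes 3 l even, and 10 is the only even
        candidate.\<close>
      have "l = 10" using lc e by presburger
      moreover from this have "c = 4" "b = 4" using vals c ord by linarith+
      ultimately show ?thesis using e by (simp add: a)
    next
      assume n: "length a = 5"
      then obtain b c e f where a: "a = [4, b, c, e, f]" using a0 by (auto simp: length_Suc_conv numeral_eq_Suc)
      have vals: "b = 4 \<or> b = 5 \<or> b = 6" "c = 4 \<or> c = 5 \<or> c = 6"
        using val[of 1] val[of 2] by (simp_all add: a numeral_eq_Suc)
      have "b + f < l" "c + e < l" using pairs[of 1] pairs[of 2] by (simp_all add: a numeral_eq_Suc)
      moreover have "b + c + e + f = 2 * l - 2" using lin by (simp add: a numeral_eq_Suc)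
      \<comment> \<open>Both pair sums are at most l - 1 and together they are 2 l - 2, so both
        bounds are attained.\<close>
      ultimately have ef: "e = l - 1 - c" "f = l - 1 - b" by linarith+
      have cub': "(l - 8) ^ 3 + (l - 2 * b) ^ 3 + (l - 2 * c) ^ 3 + (l - 2 * e) ^ 3 + (l - 2 * f) ^ 3
          = l ^ 3 - 12 * l ^ 2 + 24 * l - 16"
        using cub by (simp add: a eval_nat_numeral algebra_simps)
      have ord: "b \<le> c" "c \<le> e" "e \<le> f" using sorted by (simp_all add: a)
      have b: "b = 4 \<or> l = 11 \<and> b = 5" and c: "c = 4 \<or> l = 11 \<and> c = 5"
        using vals lc ord unfolding ef by linarith+
      consider "l = 9" "b = 4" "c = 4" | "l = 10" "b = 4" "c = 4" | "l = 11" "b = 4" "c = 4"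
        | "l = 11" "b = 4" "c = 5" | "l = 11" "b = 5" "c = 5"
        using b c lc ord by linarith
      then show ?thesis using cub' unfolding a ef by cases simp_all
    qed
  qed
qed

theorem theorem5p6:
  fixes scale :: "'k::field \<Rightarrow> 'a::ring_1 \<Rightarrow> 'a"
    and gr :: "nat \<Rightarrow> 'a set"
    and n :: nat and l :: int and a :: "int list"
    and P :: "nat \<Rightarrow> ('a, nat \<Rightarrow> 'a) gmodule"
    and d :: "nat \<Rightarrow> (nat \<Rightarrow> 'a) \<Rightarrow> (nat \<Rightarrow> 'a)"
    and \<epsilon> :: "(nat \<Rightarrow> 'a) \<Rightarrow> 'k"
  assumes regular: "AS_regular_algebra scale gr 5"
    and generated: "\<exists>x \<in> gr 1. \<exists>y \<in> gr 1. generated_by scale {x, y}"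
    and length_a: "length a = n"
    and sorted_a: "sorted a"
    and P0: "P 0 = gfree gr [0]"
    and P1: "P 1 = gfree gr [1, 1]"
    and P2: "P 2 = gfree gr a"
    and P3: "P 3 = gfree gr (map (\<lambda>j. l - j) a)"
    and P4: "P 4 = gfree gr [l - 1, l - 1]"
    and P5: "P 5 = gfree gr [l]"
    and P_above: "\<And>i. i > 5 \<Longrightarrow> P i = gfree gr []"
    and minimal_resolution: "minimal_graded_resolution gr (k_module scale gr 0) P d \<epsilon>"
    and domain: "\<And>x y :: 'a. x * y = 0 \<Longrightarrow> x = 0 \<or> y = 0"
    and GKdim_ge: "GKdim scale \<ge> 4"
  shows "(n = 3 \<and> (a = [3, 5, 5] \<or> a = [4, 4, 4] \<or> a = [3, 4, 7])) \<or>
         (n = 4 \<and> a = [4, 4, 4, 5]) \<or>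
         (n = 5 \<and> a = [4, 4, 4, 5, 5])"
proof -
  interpret R: AS_regular_algebra scale gr 5 by (rule regular)
  obtain x y where xy: "x \<in> gr 1" "y \<in> gr 1" "generated_by scale {x, y}" using generated by blast
  define ds :: "nat \<Rightarrow> int list" where
    "ds i = (if i = 0 then [0] else if i = 1 then [1, 1] else if i = 2 then a
      else if i = 3 then map (\<lambda>j. l - j) a else if i = 4 then [l - 1, l - 1]
      else if i = 5 then [l] else [])" for i
  have "P i = gfree gr (ds i)" for i
  proof (cases "i > 5")
    case True
    then show ?thesis using P_above by (simp add: ds_def)
  next
    case False
    then consider "i = 0" | "i = 1" | "i = 2" | "i = 3" | "i = 4" | "i = 5" by linarith
    then show ?thesis by cases (simp_all add: ds_def P0 P1 P2 P3 P4 P5 del: One_nat_def)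
  qed
  then have P_eq: "P = (\<lambda>i. gfree gr (ds i))" by blast
  interpret M: minimal_free_resolution scale gr "{x, y}" ds d \<epsilon>
    by unfold_locales (use xy minimal_resolution P_eq in auto)
  have ds: "ds 0 = [0]" "ds 1 = [1, 1]" "ds 2 = a" "ds 3 = map (\<lambda>j. l - j) a"
    "ds 4 = [l - 1, l - 1]" "ds 5 = [l]" "ds 6 = []"
    by (simp_all add: ds_def)
  note GK = R.GKdim_finite
  have deg: "j \<ge> int i" if "j \<in> set (ds i)" for i j
    using M.degree_ge[OF _ that] ds(1) by fastforce
  \<comment> \<open>The generator of \<open>P 5\<close> has degree at least 5.\<close>
  have l5: "l \<ge> 5" using deg[of l 5] ds(6) by simp
  have a: "0 \<le> j \<and> j \<le> l" if "j \<in> set a" for j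
    using deg[of j 2] deg[of "l - j" 3] that ds(3,4) by simp
  let ?F = "degree_poly [0] - degree_poly [1, 1] + degree_poly a - degree_poly (map (\<lambda>j. l - j) a)
      + degree_poly [l - 1, l - 1] - degree_poly [l]"
  have "GKdim scale \<le> ereal (real (order 1 ?F))"
    using M.hilbert_series_inverse[OF GK _ _ ds(1)] ds(7) unfolding ds
    by (intro M.GKdim_le_order[OF GK]) simp
  then have "ereal 4 \<le> ereal (real (order 1 ?F))" using GKdim_ge order_trans by fastforce
  then have "4 \<le> order 1 ?F" by simp
  then have "[:-1, 1:] ^ 4 dvd ?F" by (meson dvd_trans le_imp_power_dvd order_1)
  from degree_power_sums[OF this a] l5
  have lin: "(\<Sum>i<length a. l - 2 * a ! i) = l - 4"
    and cub: "(\<Sum>i<length a. (l - 2 * a ! i) ^ 3) = l ^ 3 - 12 * l ^ 2 + 24 * l - 16" by simp_all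
  \<comment> \<open>Without relations the linear identity would give l = 4.\<close>
  have "a \<noteq> []" using lin l5 by auto
  moreover have "a ! k + a ! (length a - k) < l" if "1 \<le> k" "k < length a" for k
    using M.relation_degrees_lt[OF GK R.Gorenstein _ domain, of l k] that sorted_a unfolding ds by simp
  ultimately have "a \<in> {[3, 5, 5], [4, 4, 4], [3, 4, 7], [4, 4, 4, 5], [4, 4, 4, 5, 5]}"
    using degree_list_cases[OF sorted_a _ lin cub _ l5] by blast
  then show ?thesis using length_a by auto
qed

end
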